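(* Let $\mathcal{V}$ be a finite set of unit vectors in a real space $\mathbb{R}^N$ with $|\mathcal{V}|\le M$, and suppose $|\langle v|w\rangle|\le\varepsilon$ for all distinct vectors $|v\rangle,|w\rangle\in\mathcal{V}$. Then any classical randomized algorithm for \textsc{Gaussian Distinguishing} with test set $\mathcal{V}$ must make $\Omega\left(\frac{1/\varepsilon}{\log(M/\varepsilon)}\right)$ queries.
   Context: \textsc{Gaussian Distinguishing}: a finite set $\mathcal{V}$ of unit vectors in $\mathbb{R}^N$ ("test vectors") is known to the algorithm. In each step the algorithm picks (possibly adaptively) a test vector $|v\rangle\in\mathcal{V}$ not picked before and queries it, receiving a real response $a_v\in\mathbb{R}$. The problem is to distinguish, with constant bias, the following two cases: (i) each $a_v$ is drawn independently from the Gaussian $\mathcal{N}(0,1)$; (ii) each $a_v$ equals $\langle\Psi|v\rangle$, where $|\Psi\rangle\in\mathbb{R}^N$ is a vector drawn from $\mathcal{N}(0,1)^N$ that is fixed throughout the algorithm. "With constant bias" means that the acceptance probabilities in the two cases differ by at least a positive constant; the constant implicit in $\Omega$ may depend on it but not on $\mathcal{V},M,N,\varepsilon$.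
   Formalization: The formal theorem assumes 0 < ε ≤ 1: 1/ε is undefined at ε = 0, and for ε > 1 the bound can fail (M = 2, test set {v, −v}, ε close to 2, where log(M/ε) tends to 0 though two queries suffice). *)

theory Defs
  imports "HOL-Probability.Probability" "Jordan_Normal_Form.Matrix"
begin

text \<open>
  Vectors of dimension \<open>N\<close> are the elements of \<^term>\<open>carrier_vec N\<close>, so that the dimension
  is an ordinary natural number and a constant can be chosen uniformly in it.
\<close>

definition unit_vectors :: "nat \<Rightarrow> real Matrix.vec set" where
  "unit_vectors N = {v \<in> carrier_vec N. scalar_prod v v = 1}"

text \<open>
  A deterministic adaptive query algorithm: it either stops with an answer (\<open>True\<close> means
  ``accept''), or queries a test vector and continues depending on the real response.
\<close>

datatype query_alg = Output bool | Query "real Matrix.vec" "real \<Rightarrow> query_alg"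

primrec fresh_queries :: "query_alg \<Rightarrow> real Matrix.vec set \<Rightarrow> bool" where
  "fresh_queries (Output b) W = True"
| "fresh_queries (Query v k) W = (v \<in> W \<and> (\<forall>x. fresh_queries (k x) (W - {v})))"

primrec accepts :: "query_alg \<Rightarrow> (real Matrix.vec \<Rightarrow> real) \<Rightarrow> bool" where
  "accepts (Output b) a = b"
| "accepts (Query v k) a = accepts (k (a v)) a"

primrec num_queries :: "query_alg \<Rightarrow> (real Matrix.vec \<Rightarrow> real) \<Rightarrow> nat" where
  "num_queries (Output b) a = 0"
| "num_queries (Query v k) a = Suc (num_queries (k (a v)) a)"

text \<open>
  The next action after the responses \<open>xs\<close> have been received: \<open>Inl v\<close> for a query to \<open>v\<close>,
  \<open>Inr b\<close> for output \<open>b\<close>. Responses after the algorithm has stopped are ignored.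
\<close>

primrec next_action :: "query_alg \<Rightarrow> real list \<Rightarrow> real Matrix.vec + bool" where
  "next_action (Output b) xs = Inr b"
| "next_action (Query v k) xs = (case xs of [] \<Rightarrow> Inl v | x # ys \<Rightarrow> next_action (k x) ys)"

text \<open>
  A randomized algorithm is a random deterministic one: a seed \<open>r\<close> is drawn from the
  probability space \<open>R\<close> and then \<open>T r\<close> is run. The last condition says that every action is
  a measurable function of the seed and the responses received so far.
\<close>

definition randomized_alg ::
    "real Matrix.vec set \<Rightarrow> real measure \<Rightarrow> (real \<Rightarrow> query_alg) \<Rightarrow> bool" where
  "randomized_alg V R T \<longleftrightarrow>
     prob_space R \<and>
     (\<forall>r\<in>space R. fresh_queries (T r) V) \<and>
     (\<forall>n. (\<lambda>(r, x). next_action (T r) (map x [0..<n]))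
            \<in> R \<Otimes>\<^sub>M (\<Pi>\<^sub>M i\<in>{..<n}. borel) \<rightarrow>\<^sub>M count_space UNIV)"

definition makes_at_most ::
    "real measure \<Rightarrow> (real \<Rightarrow> query_alg) \<Rightarrow> nat \<Rightarrow> bool" where
  "makes_at_most R T q \<longleftrightarrow> (\<forall>r\<in>space R. \<forall>a. num_queries (T r) a \<le> q)"

text \<open>The joint law of the family of responses \<open>(a\<^sub>v)\<close>, \<open>v \<in> V\<close>, in the two cases.\<close>

definition independent_responses ::
    "real Matrix.vec set \<Rightarrow> (real Matrix.vec \<Rightarrow> real) measure" where
  "independent_responses V = (\<Pi>\<^sub>M v\<in>V. std_normal_distribution)"

definition planted_responses ::
    "nat \<Rightarrow> real Matrix.vec set \<Rightarrow> (real Matrix.vec \<Rightarrow> real) measure" where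
  "planted_responses N V =
     distr (\<Pi>\<^sub>M i\<in>{..<N}. std_normal_distribution) (\<Pi>\<^sub>M v\<in>V. borel)
       (\<lambda>\<psi>. \<lambda>v\<in>V. scalar_prod (Matrix.vec N \<psi>) v)"

definition accept_prob ::
    "real measure \<Rightarrow> (real \<Rightarrow> query_alg) \<Rightarrow> (real Matrix.vec \<Rightarrow> real) measure \<Rightarrow> real" where
  "accept_prob R T D =
     measure (R \<Otimes>\<^sub>M D) {(r, a) \<in> space (R \<Otimes>\<^sub>M D). accepts (T r) a}"

definition distinguishes_with_bias ::
    "nat \<Rightarrow> real Matrix.vec set \<Rightarrow> real measure \<Rightarrow> (real \<Rightarrow> query_alg) \<Rightarrow> real \<Rightarrow> bool" where
  "distinguishes_with_bias N V R T \<delta> \<longleftrightarrow>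
     \<bar>accept_prob R T (independent_responses V) - accept_prob R T (planted_responses N V)\<bar> \<ge> \<delta>"

end

theory Submission
  imports Defs
begin

text \<open>
  Fix the seed and let \<open>S\<close> be the set of queried vectors. Given \<open>S\<close>, the planted responses have
  density \<open>det G\<^sup>-\<^sup>1\<^sup>/\<^sup>2 exp ((a \<bullet> a - a \<bullet> G\<inverse> a) / 2)\<close> with respect to the independent ones, \<open>G = I + e\<close> being
  the Gram matrix of \<open>S\<close>. If \<open>\<epsilon> q \<le> 1/2\<close>, this is at least \<open>exp (W - \<bar>e a\<bar>\<^sup>2) \<ge> 1 - \<bar>W\<bar> - \<bar>e a\<bar>\<^sup>2\<close> where
  \<open>W = (a \<bullet> e a) / 2\<close>. As the finitely many possible \<open>S\<close> partition the acceptance event and its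
  complement, the bias is at most the expectation of \<open>\<bar>W\<bar> + \<bar>e a\<bar>\<^sup>2\<close> under independent responses.
  There, for each fixed \<open>w \<in> V\<close>, the sum of \<open>\<langle>w|v\<rangle> a\<^sub>v\<close> over the queried \<open>v\<close> is a martingale with
  exponential moments of variance proxy \<open>\<epsilon>\<^sup>2 q\<close>; a union bound over \<open>w\<close>, which also covers the
  adaptively chosen \<open>w\<close>, gives second moments \<open>O (\<epsilon>\<^sup>2 q log\<^sup>2 M)\<close>. Since \<open>W\<close> is a martingale too, the
  expectation is small when \<open>\<epsilon> q log M\<close> is small.
\<close>

section \<open>Characteristic functions in several variables\<close>

text \<open>The obstacle is that the planted law need not have a density on all of \<open>V\<close>:
  when \<open>V\<close> has more than \<open>N\<close> elements, its Gram matrix is singular. Only a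
  marginal on few coordinates has one, and which coordinates are read depends on the responses.
  Gaussian laws are therefore identified by characteristic functions, which tolerate degeneracy and
  pass to marginals by setting frequencies to zero; densities are then built one coordinate at a
  time, by conditioning. Lower bounds on the density suffice, because both laws have mass one and
  the complement of an event can be used for the reverse inequality. This makes the normalisation
  harmless: a Gram matrix with unit diagonal has determinant at most 1, so the factor in front of
  the exponential is at least 1. It also keeps exponential moments of \<open>W\<close> out of the
  argument; second moments are enough. The logarithm enters only through the union bound over
  \<open>V\<close>, as ln M. For \<epsilon> \<le> 1 it is dominated by ln (M / \<epsilon>), which
  for M \<ge> 2 also absorbs the additive constants.\<close>

lemma finite_measure_char_unique:
  fixes M1 M2 :: "real measure"
  assumes "finite_measure M1" "finite_measure M2"
    and sets: "sets M1 = sets borel" "sets M2 = sets borel"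
    and char: "\<And>t. char M1 t = char M2 t"
  shows "M1 = M2"
proof -
  interpret M1: finite_measure M1 by fact
  interpret M2: finite_measure M2 by fact
  have sp: "space M1 = UNIV" "space M2 = UNIV"
    using sets_eq_imp_space_eq[OF sets(1)] sets_eq_imp_space_eq[OF sets(2)] by simp_all
  define m where "m = measure M1 UNIV"
  have m2: "m = measure M2 UNIV"
    using char[of 0] sp by (simp add: char_def m_def)
  have em: "emeasure M1 UNIV = ennreal m" "emeasure M2 UNIV = ennreal m"
    using m2 m_def M1.emeasure_eq_measure M2.emeasure_eq_measure by auto
  show ?thesis
  \<comment> \<open>Levy's theorem is about probability measures, so the common mass
    \<open>m\<close>, read off from the characteristic functions at 0, has to be divided
    out.\<close>
  proof (cases "m = 0")
    case True
    show ?thesis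
    proof (rule measure_eqI)
      show "sets M1 = sets M2" using sets by simp
      fix A assume "A \<in> sets M1"
      have "emeasure M1 A \<le> emeasure M1 UNIV" "emeasure M2 A \<le> emeasure M2 UNIV"
        by (intro emeasure_mono; use sets in simp)+
      then show "emeasure M1 A = emeasure M2 A"
        using True em by simp
    qed
  next
    case False
    then have m: "m > 0" by (simp add: m_def less_le)
    define D where "D M = density M (\<lambda>x::real. ennreal (1 / m))" for M
    have D: "real_distribution (D M) \<and> char (D M) = (\<lambda>t. char M t / m)"
      if "sets M = sets borel" "space M = UNIV" "emeasure M UNIV = ennreal m" for M
    proof
      have [measurable_cong]: "sets M = sets borel" by fact
      have "emeasure (D M) (space M) = ennreal (1 / m) * ennreal m"
        unfolding D_def using that by (subst emeasure_density) (auto simp: nn_integral_cmult)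
      then show "real_distribution (D M)"
        using m that by (intro real_distribution.intro prob_spaceI real_distribution_axioms.intro)
          (auto simp: D_def ennreal_mult[symmetric])
      show "char (D M) = (\<lambda>t. char M t / m)"
        unfolding char_def D_def using m
        by (subst integral_density) (auto simp: scaleR_conv_of_real divide_inverse mult.commute)
    qed
    have "D M1 = D M2"
      using D[of M1] D[of M2] sets sp em char by (intro Levy_uniqueness) auto
    have eq: "emeasure M A = ennreal m * emeasure (D M) A"
      if "sets M = sets borel" "A \<in> sets borel" for M A
    proof -
      have "emeasure (D M) A = ennreal (1 / m) * emeasure M A"
        unfolding D_def using that by (subst emeasure_density) (auto simp: nn_integral_cmult)
      then show ?thesis
        using m by (simp add: mult.assoc[symmetric] ennreal_mult[symmetric])
    qed
    show ?thesis
      using eq[OF sets(1)] eq[OF sets(2)] sets \<open>D M1 = D M2\<close>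
      by (intro measure_eqI) auto
  qed
qed

text \<open>Uniqueness on the line is applied to the image under \<open>X\<close> of the measure
  with density \<open>g\<close>. The weight will carry the indicators of coordinates that have
  already been localised.\<close>

lemma weighted_char_unique:
  fixes g X :: "'a \<Rightarrow> real"
  assumes "finite_measure M1" "finite_measure M2" "sets M1 = sets M2"
    and [measurable]: "X \<in> borel_measurable M1" "g \<in> borel_measurable M1"
    and g: "\<And>x. 0 \<le> g x" "\<And>x. g x \<le> B"
    and char: "\<And>s. (CLINT x|M1. iexp (s * X x) * g x) = (CLINT x|M2. iexp (s * X x) * g x)"
    and A[measurable]: "A \<in> sets borel"
  shows "(\<integral>x. indicator A (X x) * g x \<partial>M1) = (\<integral>x. indicator A (X x) * g x \<partial>M2)"
proof -
  have [measurable]: "X \<in> borel_measurable M2" "g \<in> borel_measurable M2"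
    using assms(4,5) measurable_cong_sets[OF assms(3) refl] by blast+
  define D where "D M = distr (density M (\<lambda>x. ennreal (g x))) borel X" for M
  have D: "finite_measure (D M) \<and> char (D M) = (\<lambda>s. CLINT x|M. iexp (s * X x) * g x)
      \<and> measure (D M) A = (\<integral>x. indicator A (X x) * g x \<partial>M)"
    if M: "finite_measure M" "X \<in> borel_measurable M" "g \<in> borel_measurable M" for M
  proof -
    interpret finite_measure M by fact
    note [measurable] = M(2,3)
    have "emeasure (density M (\<lambda>x. ennreal (g x))) (space M) = (\<integral>\<^sup>+x. ennreal (g x) \<partial>M)"
      by (subst emeasure_density) (auto intro!: nn_integral_cong)
    also have "\<dots> \<le> (\<integral>\<^sup>+x. ennreal B \<partial>M)"
      by (intro nn_integral_mono ennreal_leI g)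
    also have "\<dots> < \<infinity>" by (simp add: emeasure_eq_measure ennreal_mult''[symmetric])
    finally have "finite_measure (density M (\<lambda>x. ennreal (g x)))"
      by (intro finite_measureI) auto
    then have f: "finite_measure (D M)"
      unfolding D_def by (intro finite_measure.finite_measure_distr) auto
    have i: "integrable M (\<lambda>x. indicator A (X x) * g x)"
      using g by (intro integrable_const_bound[where B=B]) (auto simp: indicator_def intro: order_trans)
    have "emeasure (D M) A = ennreal (\<integral>x. indicator A (X x) * g x \<partial>M)"
      unfolding D_def using i g
      by (subst emeasure_distr, simp, simp, subst emeasure_density)
        (auto simp: nn_integral_eq_integral[symmetric] indicator_def intro!: nn_integral_cong)
    then have "measure (D M) A = (\<integral>x. indicator A (X x) * g x \<partial>M)"
      using g by (simp add: measure_def)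
    moreover have "char (D M) = (\<lambda>s. CLINT x|M. iexp (s * X x) * g x)"
      unfolding char_def D_def using g
      by (subst integral_distr, simp, simp, subst integral_density)
         (auto simp: scaleR_conv_of_real mult.commute)
    ultimately show ?thesis using f by blast
  qed
  have "D M1 = D M2"
    using D[of M1] D[of M2] assms(1,2) char
    by (intro finite_measure_char_unique) (auto simp: D_def)
  then show ?thesis
    using D[of M1] D[of M2] assms(1,2) by simp
qed

text \<open>
  Splits \<open>iexp T\<close> into the nonnegative weights \<open>1 + cos T\<close> and \<open>1 + sin T\<close>, to which uniqueness for
  finite measures on the line applies.
\<close>

lemma weighted_iexp_unique:
  fixes g X T :: "'a \<Rightarrow> real"
  assumes M: "finite_measure M1" "finite_measure M2" "sets M1 = sets M2"
    and [measurable]: "X \<in> borel_measurable M1" "g \<in> borel_measurable M1" "T \<in> borel_measurable M1"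
    and g: "\<And>x. 0 \<le> g x" "\<And>x. g x \<le> 1"
    and char: "\<And>s r. (CLINT x|M1. iexp (s * X x + r * T x) * g x) = (CLINT x|M2. iexp (s * X x + r * T x) * g x)"
    and A[measurable]: "A \<in> sets borel"
  shows "(CLINT x|M1. iexp (T x) * (indicator A (X x) * g x)) = (CLINT x|M2. iexp (T x) * (indicator A (X x) * g x))"
proof -
  have [measurable]: "X \<in> borel_measurable M2" "g \<in> borel_measurable M2" "T \<in> borel_measurable M2"
    using assms(4,5,6) measurable_cong_sets[OF assms(3) refl] by blast+
  \<comment> \<open>Euler's formulas: the cosine and sine weights are combinations of the
    frequencies \<open>r = 1\<close> and \<open>r = - 1\<close> of the hypothesis.\<close>
  have c: "(CLINT x|M. iexp (s * X x) * (of_real (cos (T x)) * g x)) =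
       ((CLINT x|M. iexp (s * X x + 1 * T x) * g x) + (CLINT x|M. iexp (s * X x + (- 1) * T x) * g x)) / 2
    \<and> (CLINT x|M. iexp (s * X x) * (of_real (sin (T x)) * g x)) =
       ((CLINT x|M. iexp (s * X x + 1 * T x) * g x) - (CLINT x|M. iexp (s * X x + (- 1) * T x) * g x)) / (2 * \<i>)
    \<and> integrable M (\<lambda>x. iexp (s * X x) * g x)
    \<and> integrable M (\<lambda>x. iexp (s * X x) * (of_real (cos (T x)) * g x))
    \<and> integrable M (\<lambda>x. iexp (s * X x) * (of_real (sin (T x)) * g x))"
    if "finite_measure M" and [measurable]: "X \<in> borel_measurable M" "g \<in> borel_measurable M" "T \<in> borel_measurable M" for M s
  proof -
    interpret finite_measure M by fact
    have i: "integrable M (\<lambda>x. iexp (s * X x + r * T x) * g x)" for r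
      using g by (intro integrable_const_bound[where B=1]) (auto simp: norm_mult)
    have 1: "iexp (s * X x) * (of_real (cos (T x)) * g x) = (iexp (s * X x + 1 * T x) * g x + iexp (s * X x + (- 1) * T x) * g x) / 2"
      "iexp (s * X x) * (of_real (sin (T x)) * g x) = (iexp (s * X x + 1 * T x) * g x - iexp (s * X x + (- 1) * T x) * g x) / (2 * \<i>)" for x
      by (auto simp: cos_exp_eq sin_exp_eq cos_of_real[symmetric] sin_of_real[symmetric] exp_add exp_minus exp_diff field_simps distrib_left)
    have j: "integrable M (\<lambda>x. iexp (s * X x) * g x)" using i[of 0] by simp
    show ?thesis
      unfolding 1
      by (intro conjI integral_divide_zero[THEN trans] integrable_divide_zero Bochner_Integration.integrable_add
          Bochner_Integration.integrable_diff i j arg_cong2[where f="(/)"] refl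
          Bochner_Integration.integral_add Bochner_Integration.integral_diff)
  qed
  note c1 = c[OF M(1) assms(4-6)]
  note c2 = c[OF M(2) \<open>X \<in> borel_measurable M2\<close> \<open>g \<in> borel_measurable M2\<close> \<open>T \<in> borel_measurable M2\<close>]
  have g0: "(\<integral>x. indicator A (X x) * g x \<partial>M1) = (\<integral>x. indicator A (X x) * g x \<partial>M2)"
    using char[of _ 0] by (intro weighted_char_unique[OF M _ _ g]) auto
  have eq: "(\<integral>x. indicator A (X x) * (h (T x) * g x) \<partial>M1) = (\<integral>x. indicator A (X x) * (h (T x) * g x) \<partial>M2)"
    if h[measurable]: "h \<in> borel_measurable borel" and h1: "\<And>x. \<bar>h x\<bar> \<le> 1"
      and ch: "\<And>s. (CLINT x|M1. iexp (s * X x) * (of_real (h (T x)) * g x)) = (CLINT x|M2. iexp (s * X x) * (of_real (h (T x)) * g x))"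
      "\<And>s. integrable M1 (\<lambda>x. iexp (s * X x) * (of_real (h (T x)) * g x))"
      "\<And>s. integrable M2 (\<lambda>x. iexp (s * X x) * (of_real (h (T x)) * g x))"
      for h :: "real \<Rightarrow> real"
  proof -
    have b: "0 \<le> 1 + h y" "1 + h y \<le> 2" for y using h1[of y] by (auto simp: abs_le_iff)
    have "(\<integral>x. indicator A (X x) * ((1 + h (T x)) * g x) \<partial>M1) = (\<integral>x. indicator A (X x) * ((1 + h (T x)) * g x) \<partial>M2)"
    proof (rule weighted_char_unique[OF M])
      show "0 \<le> (1 + h (T x)) * g x" for x using b g by simp
      show "(1 + h (T x)) * g x \<le> 2" for x using mult_mono[OF b(2) g(2) _ g(1), of "T x" x] by simp
      show "(CLINT x|M1. iexp (s * X x) * complex_of_real ((1 + h (T x)) * g x)) =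
         (CLINT x|M2. iexp (s * X x) * complex_of_real ((1 + h (T x)) * g x))" for s
        using c1[of s] c2[of s] ch[of s] char[of s 0] by (simp add: distrib_left distrib_right)
    qed auto
    moreover have "integrable M (\<lambda>x. indicator A (X x) * g x) \<and> integrable M (\<lambda>x. indicator A (X x) * (h (T x) * g x))"
      if "finite_measure M" and [measurable]: "X \<in> borel_measurable M" "g \<in> borel_measurable M" "T \<in> borel_measurable M" for M
    proof -
      interpret finite_measure M by fact
      have "\<bar>h y * g x\<bar> \<le> 1" for x y
        using mult_mono[OF h1[of y] g(2)[of x]] g(1)[of x] by (auto simp: abs_mult)
      then show ?thesis
        using g by (intro conjI integrable_const_bound[where B=1]) (auto simp: indicator_def)
    qed
    ultimately show ?thesis
      using g0 M by (simp add: distrib_left distrib_right)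
  qed
  have C: "(\<integral>x. indicator A (X x) * (cos (T x) * g x) \<partial>M1) = (\<integral>x. indicator A (X x) * (cos (T x) * g x) \<partial>M2)"
  proof (rule eq)
    show "(CLINT x|M1. iexp (s * X x) * (of_real (cos (T x)) * g x)) = (CLINT x|M2. iexp (s * X x) * (of_real (cos (T x)) * g x))" for s
      by (simp only: c1[THEN conjunct1] c2[THEN conjunct1] char)
  qed (use c1 c2 in auto)
  have S: "(\<integral>x. indicator A (X x) * (sin (T x) * g x) \<partial>M1) = (\<integral>x. indicator A (X x) * (sin (T x) * g x) \<partial>M2)"
  proof (rule eq)
    show "(CLINT x|M1. iexp (s * X x) * (of_real (sin (T x)) * g x)) = (CLINT x|M2. iexp (s * X x) * (of_real (sin (T x)) * g x))" for s
      by (simp only: c1[THEN conjunct2, THEN conjunct1] c2[THEN conjunct2, THEN conjunct1] char)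
  qed (use c1 c2 in auto)
  have F: "(CLINT x|M. iexp (T x) * (indicator A (X x) * g x)) =
      of_real (\<integral>x. indicator A (X x) * (cos (T x) * g x) \<partial>M) + \<i> * of_real (\<integral>x. indicator A (X x) * (sin (T x) * g x) \<partial>M)"
    if "finite_measure M" and [measurable]: "X \<in> borel_measurable M" "g \<in> borel_measurable M" "T \<in> borel_measurable M" for M
  proof -
    interpret finite_measure M by fact
    have i: "integrable M (\<lambda>x. indicator A (X x) * (cos (T x) * g x))" "integrable M (\<lambda>x. indicator A (X x) * (sin (T x) * g x))"
    proof -
      have "\<bar>cos (T x) * g x\<bar> \<le> 1" "\<bar>sin (T x) * g x\<bar> \<le> 1" for x
        using mult_mono[OF abs_cos_le_one[of "T x"] g(2)[of x]] mult_mono[OF abs_sin_le_one[of "T x"] g(2)[of x]] g(1)[of x] by (auto simp: abs_mult)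
      then show "integrable M (\<lambda>x. indicator A (X x) * (cos (T x) * g x))" "integrable M (\<lambda>x. indicator A (X x) * (sin (T x) * g x))"
        by (intro integrable_const_bound[where B=1]; auto simp: indicator_def)+
    qed
    have "iexp (T x) * (indicator A (X x) * g x) = of_real (indicator A (X x) * (cos (T x) * g x)) + \<i> * of_real (indicator A (X x) * (sin (T x) * g x))" for x
      by (simp add: exp_Euler indicator_def distrib_right cos_of_real sin_of_real)
    then show ?thesis
      using i by (simp only: Bochner_Integration.integral_add integrable_of_real integral_mult_right_zero integral_of_real integrable_mult_right)
  qed
  show ?thesis
    using F[OF M(1)] F[OF M(2)] C S by simp
qed

text \<open>Exponentials are traded for indicators one coordinate at a time, \<open>J\<close> being
  the set of coordinates already treated. When \<open>J = S\<close>, the two measures agree on all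
  boxes, which determine a finite measure.\<close>

proposition PiM_char_unique:
  fixes M N :: "('i \<Rightarrow> real) measure"
  assumes S: "finite S" and fin: "finite_measure M" "finite_measure N"
    and sets: "sets M = sets (PiM S (\<lambda>_. borel))" "sets N = sets (PiM S (\<lambda>_. borel))"
    and char: "\<And>t. (CLINT x|M. iexp (\<Sum>i\<in>S. t i * x i)) = (CLINT x|N. iexp (\<Sum>i\<in>S. t i * x i))"
  shows "M = N"
proof -
  interpret M: finite_measure M by fact
  interpret N: finite_measure N by fact
  note [measurable_cong] = sets
  have step: "(CLINT x|M. iexp (\<Sum>i\<in>S-J. t i * x i) * of_real (\<Prod>j\<in>J. indicator (A j) (x j))) =
      (CLINT x|N. iexp (\<Sum>i\<in>S-J. t i * x i) * of_real (\<Prod>j\<in>J. indicator (A j) (x j)))"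
    if "finite J" "J \<subseteq> S" "\<And>j. j \<in> J \<Longrightarrow> A j \<in> sets borel" for J A t
    using that
  proof (induction arbitrary: t)
    case empty
    then show ?case using char by simp
  next
    case (insert i J)
    then have [measurable]: "\<And>j. j \<in> J \<Longrightarrow> A j \<in> sets borel" "A i \<in> sets borel" by auto
    have i: "i \<in> S" "i \<notin> J" "J \<subseteq> S" using insert by auto
    let ?g = "\<lambda>x. \<Prod>j\<in>J. indicator (A j) (x j) :: real"
    let ?T = "\<lambda>x. \<Sum>k\<in>S - insert i J. t k * x k"
    have [measurable]: "?g \<in> borel_measurable M"
    proof (rule borel_measurable_prod)
      fix j assume "j \<in> J"
      then have [measurable]: "A j \<in> sets borel" "(\<lambda>x. x j) \<in> borel_measurable M"
        using i sets by (auto intro!: measurable_component_singleton simp: measurable_cong_sets[OF sets(1) refl])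
      show "(\<lambda>x. indicator (A j) (x j)) \<in> borel_measurable M" by measurable
    qed
    have [measurable]: "(\<lambda>x. x i) \<in> borel_measurable M" "?T \<in> borel_measurable M"
      using i by (auto intro!: borel_measurable_sum borel_measurable_times measurable_component_singleton simp: measurable_cong_sets[OF sets(1) refl])
    have "(CLINT x|M. iexp (?T x) * of_real (indicator (A i) (x i) * ?g x)) = (CLINT x|N. iexp (?T x) * of_real (indicator (A i) (x i) * ?g x))"
    proof (rule weighted_iexp_unique[OF fin])
      show "sets M = sets N" using sets by simp
      show "0 \<le> ?g x" for x by (intro prod_nonneg) (auto simp: indicator_def)
      show "?g x \<le> 1" for x by (intro prod_le_1) (auto simp: indicator_def)
      fix s r
      \<comment> \<open>The frequency \<open>s\<close> at \<open>i\<close> and the common factor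
        \<open>r\<close> on the remaining coordinates bring the induction hypothesis into the
        two-parameter form that \<open>weighted_iexp_unique\<close> asks for.\<close>
      have "(\<Sum>k\<in>S-J. (if k = i then s else r * t k) * x k) = s * x i + r * ?T x" for x
      proof -
        have "S - J - {i} = S - insert i J" by auto
        then have "(\<Sum>k\<in>S-J. (if k = i then s else r * t k) * x k) =
            s * x i + (\<Sum>k\<in>S - insert i J. (if k = i then s else r * t k) * x k)"
          using S i by (subst sum.remove[of _ i]) auto
        moreover have "(\<Sum>k\<in>S - insert i J. (if k = i then s else r * t k) * x k) = r * ?T x"
          unfolding sum_distrib_left by (intro sum.cong) auto
        ultimately show ?thesis by simp
      qed
      then show "(CLINT x|M. iexp (s * x i + r * ?T x) * ?g x) = (CLINT x|N. iexp (s * x i + r * ?T x) * ?g x)"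
        using insert.IH[of "\<lambda>k. if k = i then s else r * t k"] insert.prems by simp
    qed simp_all
    then show ?case
      using insert.hyps by simp
  qed
  show ?thesis
  proof (rule measure_eqI_PiM_finite[OF S sets])
    show "range (\<lambda>n::nat. PiE S (\<lambda>_. UNIV)) \<subseteq> prod_algebra S (\<lambda>_. borel :: real measure)"
      using S by (auto intro!: prod_algebraI_finite)
    show "(\<Union>n::nat. PiE S (\<lambda>_. UNIV)) = space (PiM S (\<lambda>_. borel :: real measure))"
      by (simp add: space_PiM)
    show "emeasure M (PiE S (\<lambda>_. UNIV)) \<noteq> \<infinity>" by simp
    fix A :: "'i \<Rightarrow> real set" assume A: "\<And>i. i \<in> S \<Longrightarrow> A i \<in> sets borel"
    have *: "(CLINT x|L. of_real (\<Prod>j\<in>S. indicator (A j) (x j))) = of_real (measure L (PiE S A))"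
      if "sets L = sets (PiM S (\<lambda>_. borel))" for L
    proof -
      have sp: "space L = PiE S (\<lambda>_. UNIV)" using sets_eq_imp_space_eq[OF that] by (simp add: space_PiM)
      have "(CLINT x|L. of_real (\<Prod>j\<in>S. indicator (A j) (x j))) = (CLINT x|L. of_real (indicator (PiE S A) x))"
      proof (rule Bochner_Integration.integral_cong[OF refl])
        fix x assume "x \<in> space L"
        then have "x \<in> PiE S A \<longleftrightarrow> (\<forall>j\<in>S. x j \<in> A j)" using sp by (auto simp: PiE_iff)
        then show "of_real (\<Prod>j\<in>S. indicator (A j) (x j)) = (of_real (indicator (PiE S A) x) :: complex)"
          using S by (auto simp: indicator_def)
      qed
      also have "\<dots> = of_real (measure L (PiE S A \<inter> space L))"
        by (subst integral_complex_of_real) simp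
      also have "PiE S A \<inter> space L = PiE S A" using sp by auto
      finally show ?thesis .
    qed
    have "measure M (PiE S A) = measure N (PiE S A)"
      using step[where J=S and A=A and t="\<lambda>_. 0", OF S subset_refl A] *[OF sets(1)] *[OF sets(2)] by simp
    then show "emeasure M (PiE S A) = emeasure N (PiE S A)"
      by (simp add: M.emeasure_eq_measure N.emeasure_eq_measure)
  qed
qed

section \<open>Density of nearly independent Gaussian vectors\<close>

text \<open>The quadratic form of the Gram matrix \<open>I + e\<close>; \<open>e\<close> is assumed to vanish on the diagonal.\<close>

definition gram_form :: "('a \<Rightarrow> 'a \<Rightarrow> real) \<Rightarrow> 'a set \<Rightarrow> ('a \<Rightarrow> real) \<Rightarrow> real" where
  "gram_form e S t = (\<Sum>i\<in>S. (t i)\<^sup>2) + (\<Sum>i\<in>S. \<Sum>j\<in>S. t i * t j * e i j)"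

text \<open>Diagonal dominance: by the inequality of the means, the off-diagonal part is at most
  \<open>\<epsilon> * card S\<close> times the squared norm. In matrix terms, G \<ge> I/2.\<close>

lemma gram_form_coercive:
  fixes \<epsilon> :: real
  assumes "finite S" "\<epsilon> \<ge> 0" "\<epsilon> * card S \<le> 1/2"
    and e: "\<And>i j. i \<in> S \<Longrightarrow> j \<in> S \<Longrightarrow> \<bar>e i j\<bar> \<le> \<epsilon>"
  shows "(\<Sum>i\<in>S. (t i)\<^sup>2) / 2 \<le> gram_form e S t"
proof -
  have "- (\<Sum>i\<in>S. \<Sum>j\<in>S. t i * t j * e i j) \<le> (\<Sum>i\<in>S. \<Sum>j\<in>S. \<epsilon> * (((t i)\<^sup>2 + (t j)\<^sup>2) / 2))"
    unfolding sum_negf[symmetric]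
  proof (intro sum_mono)
    fix i j assume ij: "i \<in> S" "j \<in> S"
    have "- (t i * t j * e i j) \<le> \<bar>t i * t j\<bar> * \<bar>e i j\<bar>"
      by (metis abs_ge_minus_self abs_mult)
    also have "\<dots> \<le> \<bar>t i * t j\<bar> * \<epsilon>" using e[OF ij] by (intro mult_left_mono) auto
    also have "\<bar>t i * t j\<bar> \<le> ((t i)\<^sup>2 + (t j)\<^sup>2) / 2"
      using sum_squares_bound[of "\<bar>t i\<bar>" "\<bar>t j\<bar>"] by (simp add: abs_mult)
    then have "\<bar>t i * t j\<bar> * \<epsilon> \<le> \<epsilon> * (((t i)\<^sup>2 + (t j)\<^sup>2) / 2)"
      using assms(2) by (metis mult.commute mult_left_mono)
    finally show "- (t i * t j * e i j) \<le> \<epsilon> * (((t i)\<^sup>2 + (t j)\<^sup>2) / 2)" .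
  qed
  also have "\<dots> = (\<epsilon> * card S) * (\<Sum>i\<in>S. (t i)\<^sup>2)"
    by (simp add: sum_distrib_left[symmetric] sum_divide_distrib[symmetric] sum.distrib)
  also have "\<dots> \<le> 1/2 * (\<Sum>i\<in>S. (t i)\<^sup>2)"
    using assms(3) by (intro mult_right_mono sum_nonneg) auto
  finally show ?thesis by (simp add: gram_form_def)
qed

text \<open>Here \<open>g\<close> is G l, so this expands the quadratic form around \<open>t\<close>
  in direction \<open>l\<close>. It serves to complete the square when a coordinate is
  added.\<close>

lemma gram_form_add:
  assumes sym: "\<And>i j. i \<in> S \<Longrightarrow> j \<in> S \<Longrightarrow> e i j = e j i"
    and g: "\<And>i. i \<in> S \<Longrightarrow> g i = l i + (\<Sum>j\<in>S. e i j * l j)"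
  shows "gram_form e S (\<lambda>i. t i + s * l i) =
    gram_form e S t + 2 * s * (\<Sum>i\<in>S. t i * g i) + s\<^sup>2 * (\<Sum>i\<in>S. l i * g i)"
proof -
  have 1: "(\<Sum>i\<in>S. x i * g i) = (\<Sum>i\<in>S. x i * l i) + (\<Sum>i\<in>S. \<Sum>j\<in>S. x i * l j * e i j)" for x
    by (simp add: g distrib_left sum.distrib sum_distrib_left mult_ac)
  have 2: "(\<Sum>i\<in>S. \<Sum>j\<in>S. l i * t j * e i j) = (\<Sum>i\<in>S. \<Sum>j\<in>S. t i * l j * e i j)"
    by (subst sum.swap) (intro sum.cong refl, simp add: sym)
  have "gram_form e S (\<lambda>i. t i + s * l i) = gram_form e S t
      + s * (2 * (\<Sum>i\<in>S. t i * l i) + (\<Sum>i\<in>S. \<Sum>j\<in>S. t i * l j * e i j) + (\<Sum>i\<in>S. \<Sum>j\<in>S. l i * t j * e i j))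
      + s\<^sup>2 * ((\<Sum>i\<in>S. l i * l i) + (\<Sum>i\<in>S. \<Sum>j\<in>S. l i * l j * e i j))"
    unfolding gram_form_def
    by (simp add: sum.distrib sum_distrib_left power2_eq_square algebra_simps)
  then show ?thesis
    by (simp only: 1 2) (simp add: algebra_simps)
qed

lemma gram_form_insert:
  assumes "finite S" "w \<notin> S"
    and sym: "\<And>i j. i \<in> insert w S \<Longrightarrow> j \<in> insert w S \<Longrightarrow> e i j = e j i"
    and "e w w = 0"
  shows "gram_form e (insert w S) t = gram_form e S t + (t w)\<^sup>2 + 2 * t w * (\<Sum>j\<in>S. t j * e w j)"
proof -
  have "(\<Sum>i\<in>S. t i * t w * e i w) = t w * (\<Sum>j\<in>S. t j * e w j)"
    unfolding sum_distrib_left by (intro sum.cong refl) (use sym in auto)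
  then show ?thesis
    using assms by (simp add: gram_form_def sum.distrib sum_distrib_left algebra_simps)
qed

text \<open>
  With \<open>G = I + e\<close> the Gram matrix, \<open>G\<inverse> = I - e + e G\<inverse> e\<close>, and \<open>G \<ge> I/2\<close> bounds the last term.
\<close>

lemma inverse_gram_form_le:
  assumes coer: "\<And>t. (\<Sum>i\<in>S. (t i)\<^sup>2) / 2 \<le> gram_form e S t"
    and sym: "\<And>i j. i \<in> S \<Longrightarrow> j \<in> S \<Longrightarrow> e i j = e j i"
    and c: "\<And>i. i \<in> S \<Longrightarrow> a i = c i + (\<Sum>j\<in>S. e i j * c j)"
  shows "(\<Sum>i\<in>S. a i * c i) \<le>
    (\<Sum>i\<in>S. (a i)\<^sup>2) - (\<Sum>i\<in>S. \<Sum>j\<in>S. a i * a j * e i j) + 2 * (\<Sum>i\<in>S. (\<Sum>j\<in>S. e i j * a j)\<^sup>2)"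
proof -
  define y where "y i = (\<Sum>j\<in>S. e i j * a j)" for i
  \<comment> \<open>With c the solution of G c = a, the vector \<open>d\<close> equals e c and
    solves G d = e a = y. Hence the inner product of \<open>y\<close> and \<open>d\<close> is the
    last term in the expansion of the inverse form.\<close>
  define d where "d i = a i - c i" for i
  have dd: "y i = d i + (\<Sum>j\<in>S. e i j * d j)" if "i \<in> S" for i
    using c[OF that] by (simp add: y_def d_def right_diff_distrib sum_subtractf)
  have ec: "(\<Sum>j\<in>S. e i j * c j) = d i" if "i \<in> S" for i
    using c[OF that] by (simp add: d_def)
  have "(\<Sum>i\<in>S. y i * c i) = (\<Sum>i\<in>S. \<Sum>j\<in>S. e i j * a j * c i)"
    by (simp add: y_def sum_distrib_right)
  also have "\<dots> = (\<Sum>j\<in>S. \<Sum>i\<in>S. e i j * a j * c i)" by (rule sum.swap)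
  also have "\<dots> = (\<Sum>j\<in>S. a j * (\<Sum>i\<in>S. e j i * c i))"
    unfolding sum_distrib_left by (intro sum.cong refl) (simp add: sym)
  also have "\<dots> = (\<Sum>j\<in>S. a j * d j)" by (simp add: ec)
  finally have "(\<Sum>i\<in>S. a i * c i) = (\<Sum>i\<in>S. (a i)\<^sup>2) - (\<Sum>i\<in>S. y i * c i)"
    by (simp add: d_def power2_eq_square algebra_simps sum_subtractf)
  also have "(\<Sum>i\<in>S. y i * c i) = (\<Sum>i\<in>S. a i * y i) - (\<Sum>i\<in>S. y i * d i)"
    by (simp add: d_def algebra_simps sum_subtractf)
  also have "(\<Sum>i\<in>S. a i * y i) = (\<Sum>i\<in>S. \<Sum>j\<in>S. a i * a j * e i j)"
    by (simp add: y_def sum_distrib_left mult_ac)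
  finally have 1: "(\<Sum>i\<in>S. a i * c i) = (\<Sum>i\<in>S. (a i)\<^sup>2) - (\<Sum>i\<in>S. \<Sum>j\<in>S. a i * a j * e i j) + (\<Sum>i\<in>S. y i * d i)"
    by simp
  have "(\<Sum>i\<in>S. y i * d i) = gram_form e S d"
    by (simp add: gram_form_def dd distrib_right distrib_left sum.distrib power2_eq_square sum_distrib_left mult_ac)
  \<comment> \<open>The inner product of \<open>y\<close> and \<open>d\<close> lies between |d|^2 /
    2 and |y|^2 + |d|^2 / 4. Comparing the two gives |d|^2 / 4 \<le> |y|^2, whence the factor
    2.\<close>
  then have "(\<Sum>i\<in>S. (d i)\<^sup>2) / 2 \<le> (\<Sum>i\<in>S. y i * d i)" using coer[of d] by simp
  moreover have "(\<Sum>i\<in>S. y i * d i) \<le> (\<Sum>i\<in>S. (y i)\<^sup>2 + (d i)\<^sup>2 / 4)"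
  proof (intro sum_mono)
    fix i show "y i * d i \<le> (y i)\<^sup>2 + (d i)\<^sup>2 / 4"
      using zero_le_power2[of "y i - d i / 2"] by (simp add: power2_eq_square algebra_simps)
  qed
  ultimately have "(\<Sum>i\<in>S. y i * d i) \<le> 2 * (\<Sum>i\<in>S. (y i)\<^sup>2)"
    by (simp add: sum.distrib sum_divide_distrib[symmetric])
  then show ?thesis using 1 by (simp add: y_def)
qed

section \<open>Gaussian densities built by adding one coordinate at a time\<close>

lemma integral_iexp_normal_density:
  assumes "\<sigma> > 0"
  shows "(CLINT y|lborel. normal_density \<mu> \<sigma> y *\<^sub>R iexp (s * y)) = iexp (s * \<mu>) * exp (- (s * \<sigma>)\<^sup>2 / 2)"
proof -
  have "(CLINT y|lborel. normal_density \<mu> \<sigma> y *\<^sub>R iexp (s * y)) =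
      \<sigma> *\<^sub>R (CLINT z|lborel. normal_density \<mu> \<sigma> (\<mu> + \<sigma> * z) *\<^sub>R iexp (s * (\<mu> + \<sigma> * z)))"
    using assms by (subst lborel_integral_real_affine[where c=\<sigma> and t=\<mu>]) auto
  also have "\<dots> = (CLINT z|lborel. iexp (s * \<mu>) * (std_normal_density z *\<^sub>R iexp ((s * \<sigma>) * z)))"
    unfolding integral_scaleR_right[symmetric]
    using assms by (intro Bochner_Integration.integral_cong refl)
      (simp add: normal_density_def real_sqrt_mult power_mult_distrib exp_add[symmetric] scaleR_conv_of_real distrib_left mult_ac)
  also have "\<dots> = iexp (s * \<mu>) * char std_normal_distribution (s * \<sigma>)"
    unfolding char_def integral_mult_right_zero by (subst integral_density) auto
  also have "\<dots> = iexp (s * \<mu>) * exp (- (s * \<sigma>)\<^sup>2 / 2)"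
    by (simp add: char_std_normal_distribution)
  finally show ?thesis .
qed

text \<open>For symmetric \<open>e\<close>, the centred Gaussian law with covariance I + e. Stating
  it through the characteristic function admits singular covariances, which occur for the planted
  law on all of \<open>V\<close>.\<close>

definition gaussian_measure :: "('a \<Rightarrow> 'a \<Rightarrow> real) \<Rightarrow> 'a set \<Rightarrow> ('a \<Rightarrow> real) measure \<Rightarrow> bool" where
  "gaussian_measure e S L \<longleftrightarrow> prob_space L \<and> sets L = sets (PiM S (\<lambda>_. borel)) \<and>
     (\<forall>t. (CLINT x|L. iexp (\<Sum>i\<in>S. t i * x i)) = exp (- gram_form e S t / 2))"

lemma gaussian_measure_unique:
  "finite S \<Longrightarrow> gaussian_measure e S L \<Longrightarrow> gaussian_measure e S L' \<Longrightarrow> L = L'"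
  unfolding gaussian_measure_def
  by (intro PiM_char_unique) (auto intro: prob_space.finite_measure)

interpretation std_normal: prob_space std_normal_distribution
  using real_dist_normal_dist by (rule real_distribution.axioms)

interpretation std_normals: product_sigma_finite "\<lambda>_. std_normal_distribution"
  by standard

lemma sets_PiM_std_normal[measurable_cong]:
  "sets (PiM S (\<lambda>_. std_normal_distribution)) = sets (PiM S (\<lambda>_. borel))"
  by (intro sets_PiM_cong) auto

lemma space_PiM_std_normal: "space (PiM S (\<lambda>_. std_normal_distribution)) = PiE S (\<lambda>_. UNIV)"
  by (simp add: space_PiM)

text \<open>The factor is the likelihood ratio of a normal law with mean \<open>\<mu>\<close> and
  deviation \<open>\<sigma>\<close> to the standard one; each new coordinate multiplies the density
  by such a ratio.\<close>

lemma std_normal_density_mult_ratio: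
  assumes "\<sigma> > 0"
  shows "std_normal_density y * (1 / \<sigma> * exp ((y\<^sup>2 - (y - \<mu>)\<^sup>2 / \<sigma>\<^sup>2) / 2)) = normal_density \<mu> \<sigma> y"
proof -
  have "exp (- (y\<^sup>2 / 2)) * exp ((y\<^sup>2 - (y - \<mu>)\<^sup>2 / \<sigma>\<^sup>2) / 2) = exp (- ((y - \<mu>)\<^sup>2 / (2 * \<sigma>\<^sup>2)))"
    unfolding exp_add[symmetric] by (simp add: diff_divide_distrib)
  moreover have "1 / sqrt (2 * pi) * (1 / \<sigma>) = 1 / sqrt (2 * pi * \<sigma>\<^sup>2)"
    using assms by (simp add: real_sqrt_mult)
  ultimately show ?thesis
    unfolding normal_density_def by simp
qed

text \<open>Given the old coordinates, the new one is made normal with mean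
  \<open>\<Sum>i\<in>S. l i * a i\<close> and deviation \<open>\<sigma>\<close>. The hypothesis
  \<open>form\<close> is the completed square saying that the joint law then has the enlarged Gram
  form.\<close>

lemma gaussian_density_insert:
  fixes h :: "('a \<Rightarrow> real) \<Rightarrow> real"
  assumes S: "finite S" "w \<notin> S" and K: "K > 0" and \<sigma>: "\<sigma> > 0"
    and h[measurable]: "h \<in> borel_measurable (PiM S (\<lambda>_. borel))"
    and D: "gaussian_measure e S (density (PiM S (\<lambda>_. std_normal_distribution))
           (\<lambda>a. ennreal (K * exp (((\<Sum>i\<in>S. (a i)\<^sup>2) - h a) / 2))))"
    and form: "\<And>t. gram_form e (insert w S) t = gram_form e S (\<lambda>i. t i + t w * l i) + (t w * \<sigma>)\<^sup>2"
  shows "gaussian_measure e (insert w S) (density (PiM (insert w S) (\<lambda>_. std_normal_distribution))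
           (\<lambda>a. ennreal (K / \<sigma> * exp (((\<Sum>i\<in>insert w S. (a i)\<^sup>2)
              - (h (restrict a S) + (a w - (\<Sum>i\<in>S. l i * a i))\<^sup>2 / \<sigma>\<^sup>2)) / 2))))"
    (is "gaussian_measure e _ (density ?P (\<lambda>a. ennreal (?f a)))")
proof -
  let ?Q = "PiM S (\<lambda>_. std_normal_distribution) :: ('a \<Rightarrow> real) measure"
  let ?N = "std_normal_distribution"
  define f where "f = ?f"
  define g where "g a = K * exp (((\<Sum>i\<in>S. (a i)\<^sup>2) - h a) / 2)" for a
  define \<mu> where "\<mu> a = (\<Sum>i\<in>S. l i * a i)" for a
  define r where "r a y = 1 / \<sigma> * exp ((y\<^sup>2 - (y - \<mu> a)\<^sup>2 / \<sigma>\<^sup>2) / 2)" for a y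
  have [measurable]: "(\<lambda>a. restrict a S) \<in> PiM (insert w S) (\<lambda>_. borel) \<rightarrow>\<^sub>M PiM S (\<lambda>_. borel)"
    by (rule measurable_restrict_subset) auto
  have [measurable]: "f \<in> borel_measurable (PiM (insert w S) (\<lambda>_. borel))"
    unfolding f_def by measurable
  have [measurable]: "\<mu> \<in> borel_measurable (PiM S (\<lambda>_. borel))"
    unfolding \<mu>_def by measurable
  have [measurable]: "g \<in> borel_measurable (PiM S (\<lambda>_. borel))"
    unfolding g_def by measurable
  have pos: "0 \<le> f a" "0 \<le> g b" "0 \<le> r b y" for a b y
    using K \<sigma> by (auto simp: f_def g_def r_def)
  have upd: "f (a(w := y)) = g a * r a y" if "a \<in> space ?Q" for a y
  proof -
    have 1: "restrict (a(w := y)) S = a"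
      using that S by (auto simp: space_PiM_std_normal PiE_iff extensional_def fun_eq_iff)
    have 2: "(\<Sum>i\<in>S. F i ((a(w := y)) i)) = (\<Sum>i\<in>S. F i (a i))" for F :: "'a \<Rightarrow> real \<Rightarrow> real"
      using S by (intro sum.cong) auto
    show ?thesis
      using S unfolding f_def 1
      by (simp add: 2[of "\<lambda>i x. x\<^sup>2"] 2[of "\<lambda>i x. l i * x"] g_def r_def \<mu>_def exp_add[symmetric] diff_divide_distrib add_divide_distrib algebra_simps del: fun_upd_apply)
        (simp add: exp_add[symmetric] algebra_simps)
  qed
  have r[measurable]: "r a \<in> borel_measurable borel" for a unfolding r_def by measurable
  have dens: "std_normal_density y * r a y = normal_density (\<mu> a) \<sigma> y" for a y
    unfolding r_def by (rule std_normal_density_mult_ratio[OF \<sigma>])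
  have r1: "(\<integral>\<^sup>+y. ennreal (r a y) \<partial>?N) = 1" for a
  proof -
    interpret prob_space "density lborel (normal_density (\<mu> a) \<sigma>)"
      by (rule prob_space_normal_density[OF \<sigma>])
    have "(\<integral>\<^sup>+y. ennreal (r a y) \<partial>?N) = (\<integral>\<^sup>+y. ennreal (normal_density (\<mu> a) \<sigma> y) \<partial>lborel)"
      by (subst nn_integral_density) (auto simp: dens[symmetric] ennreal_mult pos intro!: nn_integral_cong)
    also have "\<dots> = 1" using emeasure_space_1 by (simp add: emeasure_density)
    finally show ?thesis .
  qed
  have r2: "(CLINT y|?N. r a y *\<^sub>R iexp (s * y)) = iexp (s * \<mu> a) * exp (- (s * \<sigma>)\<^sup>2 / 2)" for a s
    using integral_iexp_normal_density[OF \<sigma>, of "\<mu> a" s]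
    by (subst integral_density) (auto simp: dens)
  have D': "prob_space (density ?Q g)" "\<And>t. (CLINT x|density ?Q g. iexp (\<Sum>i\<in>S. t i * x i)) = exp (- gram_form e S t / 2)"
    using D by (auto simp: gaussian_measure_def g_def[abs_def])
  have nn: "(\<integral>\<^sup>+a. ennreal (f a) \<partial>?P) = 1"
  proof -
    have "(\<integral>\<^sup>+a. ennreal (f a) \<partial>?P) = (\<integral>\<^sup>+a. (\<integral>\<^sup>+y. ennreal (f (a(w := y))) \<partial>?N) \<partial>?Q)"
      by (subst std_normals.product_nn_integral_insert[OF S]) auto
    also have "\<dots> = (\<integral>\<^sup>+a. ennreal (g a) * (\<integral>\<^sup>+y. ennreal (r a y) \<partial>?N) \<partial>?Q)"
      by (intro nn_integral_cong) (simp add: upd ennreal_mult pos nn_integral_cmult)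
    also have "\<dots> = 1"
      using prob_space.emeasure_space_1[OF D'(1)] by (simp add: r1 emeasure_density cong: nn_integral_cong_simp)
    finally show ?thesis .
  qed
  show ?thesis
    unfolding gaussian_measure_def
  proof (intro conjI allI)
    have "emeasure (density ?P f) (space (density ?P f)) = 1"
      using nn by (subst emeasure_density) (auto cong: nn_integral_cong_simp)
    then show "prob_space (density ?P ?f)" unfolding f_def by (rule prob_spaceI)
    show "sets (density ?P ?f) = sets (PiM (insert w S) (\<lambda>_. borel))"
      by (simp add: sets_PiM_std_normal)
    fix t :: "'a \<Rightarrow> real"
    let ?T = "\<lambda>a. \<Sum>i\<in>S. t i * a i"
    have int: "integrable ?P (\<lambda>a. f a *\<^sub>R iexp (\<Sum>i\<in>insert w S. t i * a i))"
      using nn by (intro integrableI_bounded) (auto simp: pos)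
    have "(CLINT a|density ?P f. iexp (\<Sum>i\<in>insert w S. t i * a i)) =
        (CLINT a|?P. f a *\<^sub>R iexp (\<Sum>i\<in>insert w S. t i * a i))"
      by (subst integral_density) (auto simp: pos)
    also have "\<dots> = (CLINT a|?Q. (CLINT y|?N. f (a(w := y)) *\<^sub>R iexp (\<Sum>i\<in>insert w S. t i * (a(w := y)) i)))"
      by (rule std_normals.product_integral_insert[OF S int])
    also have "\<dots> = (CLINT a|?Q. g a *\<^sub>R (iexp (?T a) * (CLINT y|?N. r a y *\<^sub>R iexp (t w * y))))"
    proof (intro Bochner_Integration.integral_cong refl)
      fix a assume a: "a \<in> space ?Q"
      have "(\<Sum>i\<in>insert w S. t i * (a(w := y)) i) = ?T a + t w * y" for y
      proof -
        have "(\<Sum>i\<in>S. t i * (a(w := y)) i) = ?T a" using S by (intro sum.cong) auto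
        then show ?thesis using S by simp
      qed
      then have "f (a(w := y)) *\<^sub>R iexp (\<Sum>i\<in>insert w S. t i * (a(w := y)) i) = (g a *\<^sub>R iexp (?T a)) * (r a y *\<^sub>R iexp (t w * y))" for y
        unfolding upd[OF a] by (simp add: exp_add distrib_left scaleR_conv_of_real mult_ac)
      then show "(CLINT y|?N. f (a(w := y)) *\<^sub>R iexp (\<Sum>i\<in>insert w S. t i * (a(w := y)) i))
         = g a *\<^sub>R (iexp (?T a) * (CLINT y|?N. r a y *\<^sub>R iexp (t w * y)))"
        by (simp only: integral_mult_right_zero) (simp add: scaleR_conv_of_real)
    qed
    \<comment> \<open>Integrating out the new coordinate leaves a Gaussian factor and, through the
      conditional mean, adds \<open>t w * l i\<close> to the old frequencies; these are the two
      terms of \<open>form\<close>.\<close>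
    also have "\<dots> = (CLINT a|?Q. exp (- (t w * \<sigma>)\<^sup>2 / 2) * (g a *\<^sub>R iexp (\<Sum>i\<in>S. (t i + t w * l i) * a i)))"
    proof (intro Bochner_Integration.integral_cong refl)
      fix a
      have "(\<Sum>i\<in>S. (t i + t w * l i) * a i) = ?T a + t w * \<mu> a"
        by (simp add: \<mu>_def sum_distrib_left sum.distrib distrib_right distrib_left mult_ac)
      then show "g a *\<^sub>R (iexp (?T a) * (CLINT y|?N. r a y *\<^sub>R iexp (t w * y))) =
         exp (- (t w * \<sigma>)\<^sup>2 / 2) * (g a *\<^sub>R iexp (\<Sum>i\<in>S. (t i + t w * l i) * a i))"
        unfolding r2 by (simp add: exp_add distrib_left scaleR_conv_of_real mult_ac)
    qed
    also have "\<dots> = exp (- (t w * \<sigma>)\<^sup>2 / 2) * (CLINT a|density ?Q g. iexp (\<Sum>i\<in>S. (t i + t w * l i) * a i))"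
      unfolding integral_mult_right_zero by (subst integral_density) (auto simp: pos)
    also have "\<dots> = exp (- gram_form e (insert w S) t / 2)"
      unfolding D'(2) form by (simp add: exp_add[symmetric] add_divide_distrib flip: of_real_mult)
    finally show "(CLINT a|density ?P ?f. iexp (\<Sum>i\<in>insert w S. t i * a i)) = exp (- gram_form e (insert w S) t / 2)"
      unfolding f_def .
  qed
qed

text \<open>
  \<open>h a\<close> is the inverse Gram form \<open>a \<bullet> G\<inverse> a\<close>, and \<open>K = (det G)\<^sup>-\<^sup>1\<^sup>/\<^sup>2\<close>.
\<close>

proposition gaussian_density_exists:
  fixes \<epsilon> :: real
  assumes "finite S" "\<epsilon> \<ge> 0" "\<epsilon> * card S \<le> 1/2"
    and "\<And>i j. i \<in> S \<Longrightarrow> j \<in> S \<Longrightarrow> \<bar>e i j\<bar> \<le> \<epsilon>"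
    and "\<And>i j. i \<in> S \<Longrightarrow> j \<in> S \<Longrightarrow> e i j = e j i"
    and "\<And>i. i \<in> S \<Longrightarrow> e i i = 0"
  shows "\<exists>K h. K \<ge> 1 \<and> h \<in> borel_measurable (PiM S (\<lambda>_. borel)) \<and>
     (\<forall>a. \<exists>c. (\<forall>i\<in>S. a i = c i + (\<Sum>j\<in>S. e i j * c j)) \<and> h (restrict a S) = (\<Sum>i\<in>S. a i * c i)) \<and>
     gaussian_measure e S (density (PiM S (\<lambda>_. std_normal_distribution))
       (\<lambda>a. ennreal (K * exp (((\<Sum>i\<in>S. (a i)\<^sup>2) - h a) / 2))))"
  using assms
proof (induction S)
  case empty
  have [simp]: "density (PiM {} (\<lambda>_. std_normal_distribution)) (\<lambda>_. 1) = (PiM {} (\<lambda>_. std_normal_distribution) :: ('a \<Rightarrow> real) measure)"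
    by (rule density_1)
  have [simp]: "measure (PiM {} (\<lambda>_. std_normal_distribution)) (space (PiM {} (\<lambda>_. std_normal_distribution :: real measure) :: ('a \<Rightarrow> real) measure)) = 1"
    by (intro prob_space.prob_space prob_space_PiM std_normal.prob_space_axioms)
  show ?case
    by (intro exI[of _ 1] exI[of _ "\<lambda>_. 0"])
      (auto simp: gaussian_measure_def gram_form_def sets_PiM_std_normal intro!: prob_space_PiM std_normal.prob_space_axioms prob_space.prob_space)
next
  case (insert w S)
  have sub: "\<epsilon> * card S \<le> 1/2"
  proof -
    have "\<epsilon> * card S \<le> \<epsilon> * card (insert w S)" using insert by (intro mult_left_mono) auto
    then show ?thesis using insert by linarith
  qed
  then obtain K h where K: "K \<ge> 1" and h[measurable]: "h \<in> borel_measurable (PiM S (\<lambda>_. borel))"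
    and hc: "\<And>a. \<exists>c. (\<forall>i\<in>S. a i = c i + (\<Sum>j\<in>S. e i j * c j)) \<and> h (restrict a S) = (\<Sum>i\<in>S. a i * c i)"
    and D: "gaussian_measure e S (density (PiM S (\<lambda>_. std_normal_distribution))
       (\<lambda>a. ennreal (K * exp (((\<Sum>i\<in>S. (a i)\<^sup>2) - h a) / 2))))"
    using insert.IH[OF insert.prems(1) sub] insert.prems by blast
  have sym: "\<And>i j. i \<in> insert w S \<Longrightarrow> j \<in> insert w S \<Longrightarrow> e i j = e j i"
    using insert by blast
  \<comment> \<open>Applied to the covariances \<open>e w\<close> of the new coordinate with the old
    ones, the induction hypothesis solves G l = e w. So \<open>l\<close> consists of the regression
    coefficients, \<open>\<tau>\<close> is the explained variance, and \<open>1 - \<tau>\<close> is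
    the Schur complement.\<close>
  obtain l where l: "\<And>i. i \<in> S \<Longrightarrow> e w i = l i + (\<Sum>j\<in>S. e i j * l j)"
    using hc[of "e w"] by blast
  define \<tau> where "\<tau> = (\<Sum>i\<in>S. l i * e w i)"
  have form0: "gram_form e (insert w S) t = gram_form e S (\<lambda>i. t i + t w * l i) + (t w)\<^sup>2 * (1 - \<tau>)" for t
  proof -
    have "gram_form e (insert w S) t = gram_form e S t + (t w)\<^sup>2 + 2 * t w * (\<Sum>j\<in>S. t j * e w j)"
      using insert sym by (intro gram_form_insert) auto
    moreover have "gram_form e S (\<lambda>i. t i + t w * l i) = gram_form e S t + 2 * t w * (\<Sum>j\<in>S. t j * e w j) + (t w)\<^sup>2 * \<tau>"
      unfolding \<tau>_def using l sym by (intro gram_form_add) auto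
    ultimately show ?thesis by (simp add: algebra_simps)
  qed
  \<comment> \<open>This yields \<open>\<sigma> \<le> 1\<close>, so that dividing by
    \<open>\<sigma>\<close> keeps the constant \<open>K\<close> at least 1: Hadamard's determinant
    inequality, one step at a time.\<close>
  have "0 \<le> \<tau>"
  proof -
    have "gram_form e S (\<lambda>i. 0 + 1 * l i) = gram_form e S (\<lambda>_. 0) + 2 * 1 * (\<Sum>j\<in>S. 0 * e w j) + 1\<^sup>2 * \<tau>"
      unfolding \<tau>_def using l sym by (intro gram_form_add) auto
    then have "gram_form e S l = \<tau>" by (simp add: gram_form_def)
    moreover have "(\<Sum>i\<in>S. (l i)\<^sup>2) / 2 \<le> gram_form e S l"
      using insert sub by (intro gram_form_coercive) auto
    ultimately show ?thesis using sum_nonneg[of S "\<lambda>i. (l i)\<^sup>2"] by simp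
  qed
  moreover have "1 - \<tau> \<ge> 1/2"
  proof -
    \<comment> \<open>These are the coefficients of the regression residual. The shifted old part
      vanishes, so the form equals the Schur complement, and coercivity bounds it below.\<close>
    define t where "t i = (if i = w then 1 else - l i)" for i
    have "gram_form e S (\<lambda>i. t i + t w * l i) = gram_form e S (\<lambda>_. 0)"
      unfolding gram_form_def using insert.hyps by (intro arg_cong2[where f="(+)"] sum.cong refl) (auto simp: t_def)
    then have "gram_form e (insert w S) t = 1 - \<tau>"
      unfolding form0 by (simp add: t_def gram_form_def)
    moreover have "(\<Sum>i\<in>insert w S. (t i)\<^sup>2) / 2 \<le> gram_form e (insert w S) t"
      using insert by (intro gram_form_coercive) auto
    moreover have "(\<Sum>i\<in>insert w S. (t i)\<^sup>2) \<ge> 1"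
      using insert.hyps sum_nonneg[of S "\<lambda>i. (t i)\<^sup>2"] by (simp add: t_def)
    ultimately show ?thesis by simp
  qed
  ultimately obtain \<sigma> where \<sigma>: "\<sigma> > 0" "\<sigma> \<le> 1" "\<sigma>\<^sup>2 = 1 - \<tau>"
    by (intro that[of "sqrt (1 - \<tau>)"]) auto
  define \<mu> where "\<mu> a = (\<Sum>i\<in>S. l i * a i)" for a
  let ?h = "\<lambda>a. h (restrict a S) + (a w - \<mu> a)\<^sup>2 / \<sigma>\<^sup>2"
  have [measurable]: "(\<lambda>a. restrict a S) \<in> PiM (insert w S) (\<lambda>_. borel) \<rightarrow>\<^sub>M PiM S (\<lambda>_. borel)"
    by (rule measurable_restrict_subset) auto
  have *: "\<exists>c. (\<forall>i\<in>insert w S. a i = c i + (\<Sum>j\<in>insert w S. e i j * c j)) \<and> ?h (restrict a (insert w S)) = (\<Sum>i\<in>insert w S. a i * c i)" for a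
  proof -
    obtain c where c: "\<And>i. i \<in> S \<Longrightarrow> a i = c i + (\<Sum>j\<in>S. e i j * c j)" "h (restrict a S) = (\<Sum>i\<in>S. a i * c i)"
      using hc by blast
    \<comment> \<open>Block inversion of the bordered matrix: \<open>s\<close> is the residual
      divided by the Schur complement, and the old solution is corrected by
      \<open>- s * l i\<close>.\<close>
    define s where "s = (a w - \<mu> a) / \<sigma>\<^sup>2"
    define c' where "c' i = (if i = w then s else c i - s * l i)" for i
    have c'S: "(\<Sum>j\<in>S. F j * c' j) = (\<Sum>j\<in>S. F j * c j) - s * (\<Sum>j\<in>S. F j * l j)" for F
    proof -
      have "(\<Sum>j\<in>S. F j * c' j) = (\<Sum>j\<in>S. F j * (c j - s * l j))"
        using insert.hyps by (intro sum.cong) (auto simp: c'_def)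
      then show ?thesis by (simp add: right_diff_distrib sum_subtractf sum_distrib_left mult_ac)
    qed
    have "a i = c' i + (\<Sum>j\<in>insert w S. e i j * c' j)" if "i \<in> S" for i
      using c(1)[OF that] l[OF that] insert.hyps that sym[of i w]
      by (auto simp: c'S) (auto simp: c'_def algebra_simps)
    moreover have "a w = c' w + (\<Sum>j\<in>insert w S. e w j * c' j)"
    proof -
      have "(\<Sum>j\<in>S. e w j * c j) = (\<Sum>j\<in>S. l j * c j) + (\<Sum>j\<in>S. \<Sum>i\<in>S. e j i * l i * c j)"
        by (simp add: l distrib_right sum.distrib sum_distrib_right)
      also have "(\<Sum>j\<in>S. \<Sum>i\<in>S. e j i * l i * c j) = (\<Sum>i\<in>S. l i * (\<Sum>j\<in>S. e i j * c j))"
        unfolding sum_distrib_left by (subst sum.swap) (intro sum.cong refl, simp add: sym)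
      also have "(\<Sum>j\<in>S. l j * c j) + (\<Sum>i\<in>S. l i * (\<Sum>j\<in>S. e i j * c j)) = \<mu> a"
        unfolding \<mu>_def sum.distrib[symmetric] by (intro sum.cong refl) (simp add: c distrib_left)
      finally have "(\<Sum>j\<in>S. e w j * c j) = \<mu> a" .
      moreover have "(\<Sum>j\<in>S. e w j * l j) = \<tau>" by (simp add: \<tau>_def mult.commute)
      moreover have "s * \<sigma>\<^sup>2 = a w - \<mu> a" using \<sigma>(1) by (simp add: s_def)
      then have "s - s * \<tau> = a w - \<mu> a" by (simp add: \<sigma>(3) algebra_simps)
      ultimately show ?thesis
        using insert.hyps insert.prems(5) by (simp add: c'S) (simp add: c'_def)
    qed
    moreover have "?h (restrict a (insert w S)) = (\<Sum>i\<in>insert w S. a i * c' i)"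
    proof -
      have "restrict (restrict a (insert w S)) S = restrict a S" by (auto simp: restrict_def)
      moreover have "\<mu> (restrict a (insert w S)) = \<mu> a" by (simp add: \<mu>_def)
      moreover have "(\<Sum>j\<in>S. a j * l j) = \<mu> a" by (simp add: \<mu>_def mult.commute)
      ultimately show ?thesis
        using insert.hyps c(2) by (simp add: c'S) (simp add: c'_def s_def power2_eq_square diff_divide_distrib add_divide_distrib algebra_simps)
    qed
    ultimately show ?thesis by (intro exI[of _ c']) auto
  qed
  have "K / \<sigma> \<ge> 1" using K \<sigma> by (simp add: field_simps)
  moreover have "?h \<in> borel_measurable (PiM (insert w S) (\<lambda>_. borel))"
    unfolding \<mu>_def by measurable
  moreover have "gaussian_measure e (insert w S) (density (PiM (insert w S) (\<lambda>_. std_normal_distribution))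
           (\<lambda>a. ennreal (K / \<sigma> * exp (((\<Sum>i\<in>insert w S. (a i)\<^sup>2) - ?h a) / 2))))"
    unfolding \<mu>_def using insert.hyps K \<sigma> D
    by (intro gaussian_density_insert) (auto simp: form0 power_mult_distrib)
  ultimately show ?case
    using * by (intro exI[of _ "K / \<sigma>"] exI[of _ ?h]) blast
qed

section \<open>Adaptive exploration of independent Gaussians\<close>

lemma nn_integral_std_normal_exp:
  "(\<integral>\<^sup>+y. ennreal (exp (\<alpha> + \<beta> * y)) \<partial>std_normal_distribution) = ennreal (exp (\<alpha> + \<beta>\<^sup>2 / 2))"
proof -
  interpret prob_space "density lborel (normal_density \<beta> 1)"
    by (rule prob_space_normal_density) simp
  have "std_normal_density y * exp (\<alpha> + \<beta> * y) = exp (\<alpha> + \<beta>\<^sup>2 / 2) * normal_density \<beta> 1 y" for y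
    by (simp add: normal_density_def exp_add[symmetric] power2_eq_square field_simps)
  then have "(\<integral>\<^sup>+y. ennreal (exp (\<alpha> + \<beta> * y)) \<partial>std_normal_distribution) =
      (\<integral>\<^sup>+y. ennreal (exp (\<alpha> + \<beta>\<^sup>2 / 2)) * ennreal (normal_density \<beta> 1 y) \<partial>lborel)"
    by (subst nn_integral_density) (auto simp: ennreal_mult[symmetric])
  also have "\<dots> = ennreal (exp (\<alpha> + \<beta>\<^sup>2 / 2)) * 1"
    using emeasure_space_1 by (simp add: nn_integral_cmult emeasure_density)
  finally show ?thesis by simp
qed

lemma nn_integral_std_normal_affine_square:
  "(\<integral>\<^sup>+y. ennreal ((\<alpha> + y * \<beta>)\<^sup>2) \<partial>std_normal_distribution) = ennreal (\<alpha>\<^sup>2 + \<beta>\<^sup>2)"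
proof -
  let ?N = std_normal_distribution
  have i: "integrable ?N (\<lambda>x. x)" "integrable ?N (\<lambda>x. x\<^sup>2)"
    using integrable_std_normal_distribution_moment[of 1] integrable_std_normal_distribution_moment[of 2] by simp_all
  have v: "(\<integral>y. y \<partial>?N) = 0" "(\<integral>y. y\<^sup>2 \<partial>?N) = 1"
    using integral_std_normal_distribution_moment_odd[of 1] std_normal_distribution_even_moments(1)[of 1]
    by (simp_all add: fact_numeral)
  have eq: "(\<lambda>y. (\<alpha> + y * \<beta>)\<^sup>2) = (\<lambda>y. \<alpha>\<^sup>2 + (2 * \<alpha> * \<beta>) * y + \<beta>\<^sup>2 * y\<^sup>2)"
    by (rule ext) (simp add: power2_eq_square algebra_simps)
  have int: "integrable ?N (\<lambda>y. (\<alpha> + y * \<beta>)\<^sup>2)"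
    unfolding eq using i by simp
  have "(\<integral>y. (\<alpha> + y * \<beta>)\<^sup>2 \<partial>?N) = (\<integral>y. \<alpha>\<^sup>2 \<partial>?N) + (2 * \<alpha> * \<beta>) * (\<integral>y. y \<partial>?N) + \<beta>\<^sup>2 * (\<integral>y. y\<^sup>2 \<partial>?N)"
    unfolding eq using i by simp
  also have "(\<integral>y. \<alpha>\<^sup>2 \<partial>?N) = \<alpha>\<^sup>2"
    using std_normal.prob_space by simp
  finally have "(\<integral>y. (\<alpha> + y * \<beta>)\<^sup>2 \<partial>?N) = \<alpha>\<^sup>2 + \<beta>\<^sup>2"
    unfolding v by simp
  moreover have "(\<integral>\<^sup>+y. ennreal ((\<alpha> + y * \<beta>)\<^sup>2) \<partial>?N) = ennreal (\<integral>y. (\<alpha> + y * \<beta>)\<^sup>2 \<partial>?N)"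
    by (rule nn_integral_eq_integral[OF int]) simp
  ultimately show ?thesis by simp
qed

text \<open>Redrawing one coordinate independently preserves a product law. This replaces
  conditional expectation given all other coordinates.\<close>

lemma nn_integral_resample:
  assumes V: "finite V" "v \<in> V" and [measurable]: "F \<in> borel_measurable (PiM V (\<lambda>_. borel))"
  shows "(\<integral>\<^sup>+a. F a \<partial>PiM V (\<lambda>_. std_normal_distribution)) =
    (\<integral>\<^sup>+a. (\<integral>\<^sup>+y. F (a(v := y)) \<partial>std_normal_distribution) \<partial>PiM V (\<lambda>_. std_normal_distribution))"
proof -
  let ?P = "\<lambda>V. PiM V (\<lambda>_. std_normal_distribution) :: ('a \<Rightarrow> real) measure"
  have ins: "insert v (V - {v}) = V" using V by auto
  have [measurable]: "(\<lambda>(a, y). a(v := y)) \<in> PiM V (\<lambda>_. borel) \<Otimes>\<^sub>M borel \<rightarrow>\<^sub>M PiM V (\<lambda>_. borel :: real measure)"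
    using measurable_add_dim[of v V "\<lambda>_. borel :: real measure"] V by (simp add: insert_absorb)
  have I: "(\<integral>\<^sup>+a. H a \<partial>?P V) = (\<integral>\<^sup>+x. (\<integral>\<^sup>+y. H (x(v := y)) \<partial>std_normal_distribution) \<partial>?P (V - {v}))"
    if [measurable]: "H \<in> borel_measurable (PiM V (\<lambda>_. borel))" for H
  proof -
    have "H \<in> borel_measurable (?P V)" by measurable
    with std_normals.product_nn_integral_insert[of "V - {v}" v H, unfolded ins] V show ?thesis by simp
  qed
  have "(\<lambda>a. \<integral>\<^sup>+y. F (a(v := y)) \<partial>std_normal_distribution) \<in> borel_measurable (PiM V (\<lambda>_. borel))"
    by measurable
  from I[OF this] I[of F] show ?thesis
    using std_normal.emeasure_space_1 by simp
qed

definition seen :: "(nat \<Rightarrow> 'b \<Rightarrow> 'a option) \<Rightarrow> nat \<Rightarrow> 'b \<Rightarrow> 'a set" where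
  "seen act n a = {v. \<exists>i<n. act i a = Some v}"

text \<open>\<open>act n a\<close> is the coordinate read at time \<open>n\<close>, and \<open>None\<close> once the exploration has stopped.\<close>

locale exploration =
  fixes V :: "'a set" and act :: "nat \<Rightarrow> ('a \<Rightarrow> real) \<Rightarrow> 'a option"
  assumes finite_V: "finite V"
    and act_measurable: "v \<in> V \<Longrightarrow> Measurable.pred (PiM V (\<lambda>_. borel)) (\<lambda>a. act n a = Some v)"
    and act_in: "act n a = Some v \<Longrightarrow> v \<in> V"
    and act_fresh: "act n a = Some v \<Longrightarrow> v \<notin> seen act n a"
    and act_cong: "(\<And>v. v \<in> seen act n a \<Longrightarrow> a v = b v) \<Longrightarrow> act n a = act n b"
begin

abbreviation "B \<equiv> PiM V (\<lambda>_. borel :: real measure)"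
abbreviation "P \<equiv> PiM V (\<lambda>_. std_normal_distribution)"

lemma prob_space_P: "prob_space P"
  by (intro prob_space_PiM std_normal.prob_space_axioms)

lemma seen_0[simp]: "seen act 0 a = {}"
  by (simp add: seen_def)

lemma seen_Suc: "seen act (Suc n) a = seen act n a \<union> set_option (act n a)"
  by (auto simp: seen_def less_Suc_eq)

lemma seen_subset: "seen act n a \<subseteq> V"
  using act_in by (auto simp: seen_def)

lemma finite_seen[simp]: "finite (seen act n a)"
  using seen_subset finite_V by (rule finite_subset)

lemma card_seen: "card (seen act n a) \<le> n"
proof (induction n)
  case (Suc n)
  have "card (set_option (act n a)) \<le> 1" by (cases "act n a") auto
  with Suc show ?case
    unfolding seen_Suc using card_Un_le[of "seen act n a" "set_option (act n a)"] by linarith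
qed simp

text \<open>The seen sets increase with time, so agreement on the last one lets
  \<open>act_cong\<close> be applied at every earlier time.\<close>

lemma seen_cong:
  assumes "\<And>v. v \<in> seen act n a \<Longrightarrow> a v = b v"
  shows "seen act n a = seen act n b"
proof -
  have "act i a = act i b" if "i < n" for i
  proof -
    have "seen act i a \<subseteq> seen act n a" using that by (auto simp: seen_def intro: less_trans)
    then show ?thesis using assms by (intro act_cong) blast
  qed
  then show ?thesis by (auto simp: seen_def)
qed

text \<open>The coordinate read at time \<open>n\<close> is fresh, so its value has not influenced
  the choices up to and including that reading. This is the pointwise form of the independence of
  the next response from the past.\<close>

lemma
  assumes "act n a = Some v"
  shows act_upd: "act n (a(v := y)) = Some v" and seen_upd: "seen act n (a(v := y)) = seen act n a"
proof -
  have "u \<in> seen act n a \<Longrightarrow> a u = (a(v := y)) u" for u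
    using act_fresh[OF assms] by auto
  then show "act n (a(v := y)) = Some v" "seen act n (a(v := y)) = seen act n a"
    using act_cong[of n a "a(v := y)"] seen_cong[of n a "a(v := y)"] assms by auto
qed

lemma act_upd_iff: "act n (a(v := y)) = Some v \<longleftrightarrow> act n a = Some v"
  using act_upd[of n a v y] act_upd[of n "a(v := y)" v "a v"] by auto

lemma measurable_act[measurable]: "Measurable.pred B (\<lambda>a. act n a = Some v)"
proof (cases "v \<in> V")
  case False
  then have "act n a \<noteq> Some v" for a using act_in by blast
  then show ?thesis by simp
qed (rule act_measurable)

lemma measurable_seen[measurable]: "Measurable.pred B (\<lambda>a. v \<in> seen act n a)"
  unfolding seen_def by measurable

lemma borel_measurable_sum_seen[measurable]:
  fixes f :: "_ \<Rightarrow> _ \<Rightarrow> real"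
  assumes [measurable]: "\<And>v. v \<in> V \<Longrightarrow> f v \<in> borel_measurable B"
  shows "(\<lambda>a. \<Sum>v\<in>seen act n a. f v a) \<in> borel_measurable B"
proof -
  have "(\<Sum>v\<in>seen act n a. f v a) = (\<Sum>v\<in>V. if v \<in> seen act n a then f v a else 0)" for a
    using seen_subset[of n a] finite_V by (simp add: sum.inter_restrict[symmetric] inf_absorb2)
  then show ?thesis by simp
qed

text \<open>The supermartingale step. The space is split by the coordinate read at time
  \<open>n\<close>; on each piece that coordinate is redrawn, which by \<open>act_upd_iff\<close>
  does not leave the piece. Only an average over one fresh response remains to be bounded.\<close>

lemma nn_integral_step:
  fixes F H :: "_ \<Rightarrow> ennreal"
  assumes [measurable]: "F \<in> borel_measurable B" "H \<in> borel_measurable B"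
    and none: "\<And>a. act n a = None \<Longrightarrow> F a \<le> H a"
    and some: "\<And>a v. act n a = Some v \<Longrightarrow> (\<integral>\<^sup>+y. F (a(v := y)) \<partial>std_normal_distribution) \<le> H a"
  shows "(\<integral>\<^sup>+a. F a \<partial>P) \<le> (\<integral>\<^sup>+a. H a \<partial>P)"
proof -
  define I where "I v a = (if act n a = Some v then 1 else 0 :: ennreal)" for v a
  define J where "J a = (if \<exists>v\<in>V. act n a = Some v then 0 else 1 :: ennreal)" for a
  have [measurable]: "I v \<in> borel_measurable B" for v unfolding I_def by measurable
  have [measurable]: "J \<in> borel_measurable B" unfolding J_def using finite_V by measurable
  have split: "F a = J a * F a + (\<Sum>v\<in>V. I v a * F a)" for F a
  proof (cases "act n a")
    case None
    then show ?thesis by (simp add: J_def I_def)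
  next
    case (Some u)
    then have "u \<in> V" by (rule act_in)
    then have "(\<Sum>v\<in>V. I v a * F a) = F a"
      using finite_V Some by (subst sum.remove[of _ u]) (auto simp: I_def intro!: sum.neutral)
    then show ?thesis using Some \<open>u \<in> V\<close> by (simp add: J_def)
  qed
  have int: "(\<integral>\<^sup>+a. F a \<partial>P) = (\<integral>\<^sup>+a. J a * F a \<partial>P) + (\<Sum>v\<in>V. \<integral>\<^sup>+a. I v a * F a \<partial>P)"
    if [measurable]: "F \<in> borel_measurable B" for F
    by (subst split) (simp add: nn_integral_add nn_integral_sum)
  have "(\<integral>\<^sup>+a. I v a * F a \<partial>P) \<le> (\<integral>\<^sup>+a. I v a * H a \<partial>P)" if "v \<in> V" for v
  proof -
    have "(\<integral>\<^sup>+a. I v a * F a \<partial>P) = (\<integral>\<^sup>+a. (\<integral>\<^sup>+y. I v (a(v := y)) * F (a(v := y)) \<partial>std_normal_distribution) \<partial>P)"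
      using finite_V that by (rule nn_integral_resample) simp
    also have "\<dots> \<le> (\<integral>\<^sup>+a. I v a * H a \<partial>P)"
      using some by (intro nn_integral_mono) (simp add: I_def act_upd_iff)
    finally show ?thesis .
  qed
  moreover have "(\<integral>\<^sup>+a. J a * F a \<partial>P) \<le> (\<integral>\<^sup>+a. J a * H a \<partial>P)"
  proof (intro nn_integral_mono)
    fix a show "J a * F a \<le> J a * H a"
      using none[of a] act_in[of n a] by (cases "act n a") (auto simp: J_def)
  qed
  ultimately show ?thesis
    unfolding int[OF assms(1)] int[OF assms(2)] by (intro add_mono sum_mono)
qed

end

section \<open>Martingales along an exploration with small correlations\<close>

locale correlated_exploration = exploration V act
  for V :: "'a set" and act :: "nat \<Rightarrow> ('a \<Rightarrow> real) \<Rightarrow> 'a option" +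
  fixes e :: "'a \<Rightarrow> 'a \<Rightarrow> real" and \<epsilon> :: real
  assumes e_le: "u \<in> V \<Longrightarrow> v \<in> V \<Longrightarrow> \<bar>e u v\<bar> \<le> \<epsilon>"
    and e_sym: "u \<in> V \<Longrightarrow> v \<in> V \<Longrightarrow> e u v = e v u"
    and e_diag: "v \<in> V \<Longrightarrow> e v v = 0"
begin

text \<open>The entry at \<open>w\<close> of e a, restricted to the responses read so far. It is
  also needed for \<open>w\<close> not yet read, since it becomes the coefficient of the response
  when \<open>w\<close> is chosen next.\<close>

definition "X w n a = (\<Sum>v\<in>seen act n a. e w v * a v)"

definition "W n a = (\<Sum>u\<in>seen act n a. \<Sum>v\<in>seen act n a. a u * a v * e u v) / 2"

lemma X_measurable[measurable]: "X w n \<in> borel_measurable B"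
  unfolding X_def by measurable

lemma W_measurable[measurable]: "W n \<in> borel_measurable B"
  unfolding W_def by measurable

lemma X_Suc_None: "act n a = None \<Longrightarrow> X w (Suc n) a = X w n a"
  by (simp add: X_def seen_Suc)

lemma W_Suc_None: "act n a = None \<Longrightarrow> W (Suc n) a = W n a"
  by (simp add: W_def seen_Suc)

lemma seen_Suc_upd:
  assumes "act n a = Some v"
  shows "seen act (Suc n) (a(v := y)) = insert v (seen act n a)"
  using act_upd[OF assms] seen_upd[OF assms] by (simp add: seen_Suc)

lemma X_Suc_Some:
  assumes "act n a = Some v"
  shows "X w (Suc n) (a(v := y)) = X w n a + e w v * y"
proof -
  have "(\<Sum>u\<in>seen act n a. e w u * (a(v := y)) u) = X w n a"
    unfolding X_def using act_fresh[OF assms] by (intro sum.cong) auto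
  then show ?thesis
    unfolding X_def seen_Suc_upd[OF assms] using act_fresh[OF assms] by simp
qed

text \<open>By symmetry the two cross terms agree, which cancels the factor 1/2, and the zero
  diagonal removes the square of \<open>y\<close>. The increment is linear in the fresh response, so
  \<open>W\<close> is a martingale with conditional variance
  \<open>(X v n a)\<^sup>2\<close>.\<close>

lemma W_Suc_Some:
  assumes "act n a = Some v"
  shows "W (Suc n) (a(v := y)) = W n a + y * X v n a"
proof -
  let ?S = "seen act n a"
  have v: "v \<notin> ?S" "v \<in> V" using act_fresh[OF assms] act_in[OF assms] by auto
  have a: "(a(v := y)) u = a u" if "u \<in> ?S" for u using v that by auto
  have 1: "(\<Sum>u\<in>?S. y * (a(v := y)) u * e v u) = y * X v n a"
    unfolding X_def sum_distrib_left by (intro sum.cong refl) (use a in \<open>simp add: mult_ac del: fun_upd_apply\<close>)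
  have "(\<Sum>u\<in>?S. (a(v := y)) u * y * e u v) = (\<Sum>u\<in>?S. y * (a(v := y)) u * e v u)"
  proof (intro sum.cong refl)
    fix u assume "u \<in> ?S"
    then have "e u v = e v u" using e_sym v seen_subset by blast
    then show "(a(v := y)) u * y * e u v = y * (a(v := y)) u * e v u" by simp
  qed
  moreover have "(\<Sum>u\<in>?S. \<Sum>w\<in>?S. (a(v := y)) u * (a(v := y)) w * e u w) = (\<Sum>u\<in>?S. \<Sum>w\<in>?S. a u * a w * e u w)"
    by (intro sum.cong refl) (use a in \<open>simp del: fun_upd_apply\<close>)
  ultimately show ?thesis
    using 1 v e_diag[of v] unfolding W_def seen_Suc_upd[OF assms]
    by (simp add: sum.distrib del: fun_upd_apply) (simp add: add_divide_distrib)
qed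

text \<open>Given the past, an increment of \<open>X w\<close> is \<open>e w v\<close> times a
  standard normal variable. Its exponential moment is at most
  \<open>exp (s\<^sup>2 * \<epsilon>\<^sup>2 / 2)\<close> whichever \<open>v\<close> is chosen, so
  for fixed \<open>w\<close> adaptivity costs nothing.\<close>

lemma exp_X_moment:
  assumes w: "w \<in> V"
  shows "(\<integral>\<^sup>+a. exp (s * X w n a) \<partial>P) \<le> exp (n * (s\<^sup>2 * \<epsilon>\<^sup>2 / 2))"
proof (induction n)
  case 0
  show ?case using prob_space.emeasure_space_1[OF prob_space_P] by (simp add: X_def)
next
  case (Suc n)
  let ?c = "exp (s\<^sup>2 * \<epsilon>\<^sup>2 / 2)"
  have "(\<integral>\<^sup>+a. exp (s * X w (Suc n) a) \<partial>P) \<le> (\<integral>\<^sup>+a. ennreal ?c * ennreal (exp (s * X w n a)) \<partial>P)"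
  proof (rule nn_integral_step[where n=n])
    fix a assume "act n a = None"
    then show "ennreal (exp (s * X w (Suc n) a)) \<le> ennreal ?c * ennreal (exp (s * X w n a))"
      by (simp add: X_Suc_None ennreal_mult[symmetric] exp_add[symmetric])
  next
    fix a v assume v: "act n a = Some v"
    have "(s * e w v)\<^sup>2 \<le> s\<^sup>2 * \<epsilon>\<^sup>2"
      using e_le[OF w act_in[OF v]] by (simp add: power_mult_distrib abs_le_square_iff[symmetric] mult_left_mono)
    moreover have "s * X w (Suc n) (a(v := y)) = s * X w n a + (s * e w v) * y" for y
      by (simp add: X_Suc_Some[OF v] algebra_simps)
    ultimately show "(\<integral>\<^sup>+y. ennreal (exp (s * X w (Suc n) (a(v := y)))) \<partial>std_normal_distribution)
        \<le> ennreal ?c * ennreal (exp (s * X w n a))"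
      by (simp only: nn_integral_std_normal_exp)
         (simp add: ennreal_mult[symmetric] exp_add[symmetric] ennreal_leI)
  qed measurable
  also have "\<dots> = ennreal ?c * (\<integral>\<^sup>+a. exp (s * X w n a) \<partial>P)"
    by (rule nn_integral_cmult) measurable
  also have "\<dots> \<le> ennreal ?c * exp (n * (s\<^sup>2 * \<epsilon>\<^sup>2 / 2))"
    using Suc.IH by (intro mult_left_mono) auto
  also have "\<dots> = exp (Suc n * (s\<^sup>2 * \<epsilon>\<^sup>2 / 2))"
    by (simp add: ennreal_mult[symmetric] exp_add[symmetric] algebra_simps add_divide_distrib)
  finally show ?case .
qed

end

text \<open>Beyond the threshold, put |x| = \<Lambda> + u and use u^2 \<le> 2 exp u. For \<Lambda> =
  ln M the prefactor exp (-\<Lambda>) = 1/M pays for a sum over M vectors, while the price is only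
  of order (ln M)^2.\<close>

lemma square_le_exp_bound:
  fixes x \<Lambda> :: real
  assumes "\<Lambda> \<ge> 0"
  shows "x\<^sup>2 \<le> 2 * \<Lambda>\<^sup>2 + 4 * exp (- \<Lambda>) * (exp x + exp (- x))"
proof (cases "\<bar>x\<bar> \<le> \<Lambda>")
  case True
  then have "x\<^sup>2 \<le> \<Lambda>\<^sup>2" using assms by (simp add: abs_le_square_iff[symmetric])
  then show ?thesis by (smt (verit) exp_gt_zero mult_pos_pos zero_le_power2)
next
  case False
  define u where "u = \<bar>x\<bar> - \<Lambda>"
  have u: "u \<ge> 0" "\<bar>x\<bar> = \<Lambda> + u" using False by (auto simp: u_def)
  have "x\<^sup>2 = (\<Lambda> + u)\<^sup>2" using u by (metis power2_abs)
  also have "\<dots> \<le> 2 * \<Lambda>\<^sup>2 + 2 * u\<^sup>2"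
    using zero_le_power2[of "\<Lambda> - u"] by (simp add: power2_eq_square algebra_simps)
  also have "u\<^sup>2 \<le> 2 * exp u" using exp_lower_Taylor_quadratic[OF u(1)] u(1) by simp
  also have "exp u = exp (- \<Lambda>) * exp \<bar>x\<bar>" by (simp add: u_def exp_add[symmetric])
  also have "exp \<bar>x\<bar> \<le> exp x + exp (- x)" by (cases "x \<ge> 0") auto
  finally show ?thesis by (simp add: mult_ac)
qed

text \<open>The parameter \<open>s\<close> rescales \<open>X w\<close>, whose variance proxy after
  \<open>q\<close> readings is \<open>\<epsilon>\<^sup>2 * q\<close>. The last condition says that
  \<open>s * X w\<close> has variance proxy at most 1, so its exponential moments are bounded by a
  constant.\<close>

locale bounded_exploration = correlated_exploration V act e \<epsilon>
  for V :: "'a set" and act e \<epsilon> +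
  fixes q M :: nat and s :: real
  assumes card_V: "card V \<le> M" and M_pos: "M \<ge> 1" and s_pos: "s > 0"
    and q_le: "q * (s\<^sup>2 * \<epsilon>\<^sup>2) \<le> 1"
begin

definition "\<beta> = (2 * (ln M)\<^sup>2 + 16) / s\<^sup>2"

text \<open>
  \<open>Z\<close> dominates all \<open>(X w)\<^sup>2\<close> simultaneously, so that \<open>w\<close> may depend on the responses; \<open>\<beta>\<close> bounds its mean.
\<close>

definition "Z n a = (2 * (ln M)\<^sup>2 + 4 / M * (\<Sum>w\<in>V. exp (s * X w n a) + exp (- s * X w n a))) / s\<^sup>2"

lemma \<beta>_nonneg: "\<beta> \<ge> 0" by (simp add: \<beta>_def)

lemma Z_nonneg: "Z n a \<ge> 0"
  by (auto simp: Z_def intro!: divide_nonneg_nonneg add_nonneg_nonneg mult_nonneg_nonneg sum_nonneg)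

lemma Z_measurable[measurable]: "Z n \<in> borel_measurable B"
  unfolding Z_def by measurable

lemma X_square_le_Z:
  assumes "w \<in> V"
  shows "(X w n a)\<^sup>2 \<le> Z n a"
proof -
  have "(s * X w n a)\<^sup>2 \<le> 2 * (ln M)\<^sup>2 + 4 * exp (- ln M) * (exp (s * X w n a) + exp (- (s * X w n a)))"
    using M_pos by (intro square_le_exp_bound) auto
  also have "exp (- ln (real M)) = 1 / M" using M_pos by (simp add: exp_minus field_simps)
  finally have 1: "(s * X w n a)\<^sup>2 \<le> 2 * (ln M)\<^sup>2 + 4 * (1 / M) * (exp (s * X w n a) + exp (- (s * X w n a)))" .
  have "exp (s * X w n a) + exp (- (s * X w n a)) \<le> (\<Sum>w\<in>V. exp (s * X w n a) + exp (- s * X w n a))"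
    using assms finite_V by (subst sum.remove[of _ w]) (auto intro!: sum_nonneg add_nonneg_nonneg)
  from mult_left_mono[OF this, of "4 / M"] 1
  have "s\<^sup>2 * (X w n a)\<^sup>2 \<le> 2 * (ln M)\<^sup>2 + 4 / M * (\<Sum>w\<in>V. exp (s * X w n a) + exp (- s * X w n a))"
    by (simp add: power_mult_distrib)
  then show ?thesis
    unfolding Z_def using s_pos by (simp add: field_simps)
qed

lemma Z_moment:
  assumes "n \<le> q"
  shows "(\<integral>\<^sup>+a. Z n a \<partial>P) \<le> ennreal \<beta>"
proof -
  have "exp (n * (s\<^sup>2 * \<epsilon>\<^sup>2 / 2)) \<le> (2::real)"
  proof -
    have "n * (s\<^sup>2 * \<epsilon>\<^sup>2) \<le> q * (s\<^sup>2 * \<epsilon>\<^sup>2)" using assms by (intro mult_right_mono) auto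
    then have "n * (s\<^sup>2 * \<epsilon>\<^sup>2 / 2) \<le> 1/2" using q_le by simp
    then have "exp (n * (s\<^sup>2 * \<epsilon>\<^sup>2 / 2)) \<le> exp (1/2::real)" by simp
    also have "\<dots> \<le> 2" by (rule exp_half_le2)
    finally show ?thesis .
  qed
  then have "ennreal (exp (n * (s\<^sup>2 * \<epsilon>\<^sup>2 / 2))) \<le> 2"
    by (metis ennreal_leI ennreal_numeral zero_le_numeral)
  then have E: "(\<integral>\<^sup>+a. exp (s * X w n a) \<partial>P) \<le> 2" "(\<integral>\<^sup>+a. exp (- s * X w n a) \<partial>P) \<le> 2" if "w \<in> V" for w
    using exp_X_moment[OF that, of s n] exp_X_moment[OF that, of "- s" n] by auto
  have c: "0 \<le> 2 * (ln M)\<^sup>2 / s\<^sup>2" "0 \<le> 4 / (M * s\<^sup>2)" by auto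
  have "(\<integral>\<^sup>+a. Z n a \<partial>P) = (\<integral>\<^sup>+a. ennreal (2 * (ln M)\<^sup>2 / s\<^sup>2) + ennreal (4 / (M * s\<^sup>2)) *
      (\<Sum>w\<in>V. ennreal (exp (s * X w n a)) + ennreal (exp (- s * X w n a))) \<partial>P)"
    by (intro nn_integral_cong)
       (simp add: Z_def sum_nonneg add_divide_distrib flip: ennreal_plus ennreal_mult')
  also have "\<dots> = ennreal (2 * (ln M)\<^sup>2 / s\<^sup>2) + ennreal (4 / (M * s\<^sup>2)) *
      (\<Sum>w\<in>V. (\<integral>\<^sup>+a. exp (s * X w n a) \<partial>P) + (\<integral>\<^sup>+a. exp (- s * X w n a) \<partial>P))"
    using prob_space.emeasure_space_1[OF prob_space_P]
    by (simp add: nn_integral_add nn_integral_cmult nn_integral_sum)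
  \<comment> \<open>Both exponentials have mean at most exp (1/2) \<le> 2. Summed over at most
    \<open>M\<close> vectors with prefactor 4/M they give the 16 in \<open>\<beta>\<close>.\<close>
  also have "\<dots> \<le> ennreal (2 * (ln M)\<^sup>2 / s\<^sup>2) + ennreal (4 / (M * s\<^sup>2)) * (\<Sum>w\<in>V. 2 + 2)"
    using E by (intro add_mono mult_left_mono sum_mono) auto
  finally have 1: "(\<integral>\<^sup>+a. Z n a \<partial>P) \<le> ennreal (2 * (ln M)\<^sup>2 / s\<^sup>2) + ennreal (4 / (M * s\<^sup>2)) * (\<Sum>w\<in>V. 2 + 2)" .
  have "(\<Sum>w\<in>V. 2 + 2 :: ennreal) = of_nat (4 * card V)" by (simp add: mult.commute)
  also have "of_nat (4 * card V) \<le> (of_nat (4 * M) :: ennreal)" using card_V by (intro of_nat_mono) simp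
  also have "(of_nat (4 * M) :: ennreal) = ennreal (4 * M)" by (simp add: ennreal_of_nat_eq_real_of_nat ennreal_mult'')
  finally have "ennreal (2 * (ln M)\<^sup>2 / s\<^sup>2) + ennreal (4 / (M * s\<^sup>2)) * (\<Sum>w\<in>V. 2 + 2) \<le>
      ennreal (2 * (ln M)\<^sup>2 / s\<^sup>2) + ennreal (4 / (M * s\<^sup>2)) * ennreal (4 * M)"
    by (intro add_mono mult_left_mono) auto
  also have "\<dots> = ennreal \<beta>"
    using M_pos s_pos by (simp add: \<beta>_def add_divide_distrib flip: ennreal_plus ennreal_mult)
  finally show ?thesis using 1 by (rule order_trans[rotated])
qed

text \<open>Conditionally centred increments are orthogonal, so their variances add. The variance of
  a step is \<open>(X v n a)\<^sup>2\<close> with \<open>v\<close> chosen from the responses, hence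
  the bound by the uniform majorant \<open>Z\<close>.\<close>

lemma W_moment:
  assumes "n \<le> q"
  shows "(\<integral>\<^sup>+a. (W n a)\<^sup>2 \<partial>P) \<le> ennreal (n * \<beta>)"
  using assms
proof (induction n)
  case 0
  show ?case by (simp add: W_def)
next
  case (Suc n)
  have "(\<integral>\<^sup>+a. (W (Suc n) a)\<^sup>2 \<partial>P) \<le> (\<integral>\<^sup>+a. ennreal ((W n a)\<^sup>2) + ennreal (Z n a) \<partial>P)"
  proof (rule nn_integral_step[where n=n])
    fix a assume "act n a = None"
    then show "ennreal ((W (Suc n) a)\<^sup>2) \<le> ennreal ((W n a)\<^sup>2) + ennreal (Z n a)"
      by (simp add: W_Suc_None)
  next
    fix a v assume v: "act n a = Some v"
    show "(\<integral>\<^sup>+y. ennreal ((W (Suc n) (a(v := y)))\<^sup>2) \<partial>std_normal_distribution) \<le> ennreal ((W n a)\<^sup>2) + ennreal (Z n a)"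
      unfolding W_Suc_Some[OF v] nn_integral_std_normal_affine_square
      using X_square_le_Z[OF act_in[OF v]] Z_nonneg by (simp add: ennreal_leI flip: ennreal_plus)
  qed measurable
  also have "\<dots> = (\<integral>\<^sup>+a. (W n a)\<^sup>2 \<partial>P) + (\<integral>\<^sup>+a. Z n a \<partial>P)"
    by (rule nn_integral_add) measurable
  also have "\<dots> \<le> ennreal (n * \<beta>) + ennreal \<beta>"
    using Suc Z_moment[of n] by (intro add_mono) auto
  also have "\<dots> = ennreal (Suc n * \<beta>)"
    using \<beta>_nonneg by (simp add: algebra_simps flip: ennreal_plus)
  finally show ?case .
qed

text \<open>Young's inequality turns \<open>\<bar>W\<bar>\<close> into \<open>W\<^sup>2\<close> at
  the price of \<theta>/2, and each of the at most \<open>q\<close> squares is below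
  \<open>Z\<close>. The final argument takes \<theta> = \<delta>, which spends half of the bias on
  the first term.\<close>

lemma log_likelihood_moment:
  assumes \<theta>: "\<theta> > 0"
  shows "(\<integral>\<^sup>+a. ennreal (\<bar>W q a\<bar> + (\<Sum>w\<in>seen act q a. (X w q a)\<^sup>2)) \<partial>P)
    \<le> ennreal (\<theta> / 2 + q * \<beta> / (2 * \<theta>) + q * \<beta>)"
proof -
  have "(\<integral>\<^sup>+a. ennreal (\<bar>W q a\<bar> + (\<Sum>w\<in>seen act q a. (X w q a)\<^sup>2)) \<partial>P) \<le>
     (\<integral>\<^sup>+a. ennreal (\<theta> / 2) + ennreal (1 / (2 * \<theta>)) * ennreal ((W q a)\<^sup>2) + ennreal q * ennreal (Z q a) \<partial>P)"
  proof (intro nn_integral_mono)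
    fix a
    have "2 * \<theta> * \<bar>W q a\<bar> \<le> \<theta>\<^sup>2 + (W q a)\<^sup>2"
      using sum_squares_bound[of \<theta> "\<bar>W q a\<bar>"] by simp
    then have "\<bar>W q a\<bar> \<le> \<theta> / 2 + 1 / (2 * \<theta>) * (W q a)\<^sup>2"
      using \<theta> by (simp add: field_simps power2_eq_square)
    moreover have "(\<Sum>w\<in>seen act q a. (X w q a)\<^sup>2) \<le> (\<Sum>w\<in>seen act q a. Z q a)"
      using X_square_le_Z seen_subset by (intro sum_mono) blast
    then have "(\<Sum>w\<in>seen act q a. (X w q a)\<^sup>2) \<le> card (seen act q a) * Z q a" by simp
    moreover have "card (seen act q a) * Z q a \<le> q * Z q a"
      using card_seen Z_nonneg by (intro mult_right_mono) auto
    ultimately have "\<bar>W q a\<bar> + (\<Sum>w\<in>seen act q a. (X w q a)\<^sup>2) \<le> \<theta> / 2 + 1 / (2 * \<theta>) * (W q a)\<^sup>2 + q * Z q a"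
      by linarith
    then show "ennreal (\<bar>W q a\<bar> + (\<Sum>w\<in>seen act q a. (X w q a)\<^sup>2)) \<le>
      ennreal (\<theta> / 2) + ennreal (1 / (2 * \<theta>)) * ennreal ((W q a)\<^sup>2) + ennreal q * ennreal (Z q a)"
      using \<theta> Z_nonneg[of q a] by (simp add: ennreal_leI flip: ennreal_plus ennreal_mult)
  qed
  also have "\<dots> = ennreal (\<theta> / 2) + ennreal (1 / (2 * \<theta>)) * (\<integral>\<^sup>+a. (W q a)\<^sup>2 \<partial>P) + ennreal q * (\<integral>\<^sup>+a. Z q a \<partial>P)"
    using prob_space.emeasure_space_1[OF prob_space_P]
    by (simp add: nn_integral_add nn_integral_cmult)
  also have "\<dots> \<le> ennreal (\<theta> / 2) + ennreal (1 / (2 * \<theta>)) * ennreal (q * \<beta>) + ennreal q * ennreal \<beta>"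
    using W_moment[of q] Z_moment[of q] by (intro add_mono mult_left_mono) auto
  also have "\<dots> = ennreal (\<theta> / 2 + q * \<beta> / (2 * \<theta>) + q * \<beta>)"
    using \<theta> \<beta>_nonneg by (simp flip: ennreal_plus ennreal_mult)
  finally show ?thesis .
qed

end

section \<open>Comparison of the two response laws\<close>

text \<open>Frequencies outside \<open>S\<close> are set to zero. This leads from the possibly
  degenerate law on \<open>V\<close> to the queried coordinates, where a density exists.\<close>

lemma gaussian_measure_restrict:
  assumes V: "finite V" "S \<subseteq> V" and Q: "gaussian_measure e V Q"
  shows "gaussian_measure e S (distr Q (PiM S (\<lambda>_. borel)) (\<lambda>a. restrict a S))"
proof -
  have [measurable_cong]: "sets Q = sets (PiM V (\<lambda>_. borel))" and "prob_space Q"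
    and Qc: "\<And>t. (CLINT x|Q. iexp (\<Sum>i\<in>V. t i * x i)) = exp (- gram_form e V t / 2)"
    using Q by (auto simp: gaussian_measure_def)
  interpret prob_space Q by fact
  have m[measurable]: "(\<lambda>a. restrict a S) \<in> Q \<rightarrow>\<^sub>M PiM S (\<lambda>_. borel)"
    using measurable_restrict_subset[OF V(2)] by measurable
  have "(CLINT x|distr Q (PiM S (\<lambda>_. borel)) (\<lambda>a. restrict a S). iexp (\<Sum>i\<in>S. t i * x i)) = exp (- gram_form e S t / 2)"
    for t :: "'a \<Rightarrow> real"
  proof -
    define u where "u i = (if i \<in> S then t i else 0)" for i
    have sum: "(\<Sum>i\<in>V. if i \<in> S then F i else 0) = (\<Sum>i\<in>S. F i)" for F :: "'a \<Rightarrow> real"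
      using V by (subst sum.inter_restrict[symmetric]) (auto simp: inf_absorb2)
    have "(CLINT x|distr Q (PiM S (\<lambda>_. borel)) (\<lambda>a. restrict a S). iexp (\<Sum>i\<in>S. t i * x i)) =
        (CLINT x|Q. iexp (\<Sum>i\<in>S. t i * x i))"
      by (subst integral_distr) auto
    also have "\<dots> = (CLINT x|Q. iexp (\<Sum>i\<in>V. u i * x i))"
    proof -
      have "(\<Sum>i\<in>V. u i * x i) = (\<Sum>i\<in>S. t i * x i)" for x
        by (subst sum[symmetric]) (auto simp: u_def intro!: sum.cong)
      then show ?thesis by simp
    qed
    also have "\<dots> = exp (- gram_form e V u / 2)" by (rule Qc)
    also have "gram_form e V u = gram_form e S t"
    proof -
      have "(\<Sum>i\<in>V. (u i)\<^sup>2) = (\<Sum>i\<in>S. (t i)\<^sup>2)"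
        by (subst sum[symmetric]) (auto simp: u_def intro!: sum.cong)
      moreover have "(\<Sum>i\<in>V. \<Sum>j\<in>V. u i * u j * e i j) = (\<Sum>i\<in>S. \<Sum>j\<in>S. t i * t j * e i j)"
      proof -
        have "(\<Sum>j\<in>V. u i * u j * e i j) = (if i \<in> S then \<Sum>j\<in>S. t i * t j * e i j else 0)" for i
        proof (cases "i \<in> S")
          case True
          then show ?thesis by (simp only: if_True, subst sum[symmetric]) (auto simp: u_def intro!: sum.cong)
        qed (simp add: u_def)
        then show ?thesis by (simp add: sum)
      qed
      ultimately show ?thesis by (simp add: gram_form_def)
    qed
    finally show ?thesis .
  qed
  then show ?thesis
    unfolding gaussian_measure_def by (auto intro: prob_space_distr)
qed

context bounded_exploration
begin

definition "R a = \<bar>W q a\<bar> + (\<Sum>w\<in>seen act q a. (X w q a)\<^sup>2)"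

lemma R_measurable[measurable]: "R \<in> borel_measurable B"
  unfolding R_def by measurable

text \<open>Once the set read is known to be \<open>S\<close>, membership in \<open>A\<close>
  depends on the coordinates in \<open>S\<close> alone. Both laws can then be evaluated on the
  marginal at \<open>S\<close>, where the density \<open>f\<close> satisfies the pointwise bound 1
  \<le> f + R on \<open>AS\<close>.\<close>

lemma emeasure_stopped_le:
  assumes \<epsilon>: "\<epsilon> \<ge> 0" "\<epsilon> * q \<le> 1/2" and Q: "gaussian_measure e V Q"
    and A[measurable]: "A \<in> sets B"
    and A_seen: "\<And>a b. a \<in> A \<Longrightarrow> b \<in> space B \<Longrightarrow> (\<And>v. v \<in> seen act q a \<Longrightarrow> a v = b v) \<Longrightarrow> b \<in> A"
    and S: "S \<subseteq> V"
  defines "AS \<equiv> {a \<in> A. seen act q a = S}"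
  shows "AS \<in> sets B" and "emeasure P AS \<le> emeasure Q AS + (\<integral>\<^sup>+a. ennreal (R a) * indicator AS a \<partial>P)"
proof -
  have [measurable_cong]: "sets Q = sets B" using Q by (auto simp: gaussian_measure_def)
  have A_space: "A \<subseteq> space B" using sets.sets_into_space[OF A] .
  have seen_eq: "seen act q a = S \<longleftrightarrow> (\<forall>v\<in>V. v \<in> seen act q a \<longleftrightarrow> v \<in> S)" for a
    using S seen_subset[of q a] by blast
  have "AS = {a \<in> space B. a \<in> A \<and> (\<forall>v\<in>V. v \<in> seen act q a \<longleftrightarrow> v \<in> S)}"
    unfolding AS_def using A_space seen_eq by blast
  also have "\<dots> \<in> sets B"
    using finite_V by measurable
  finally show AS[measurable]: "AS \<in> sets B" .
  show "emeasure P AS \<le> emeasure Q AS + (\<integral>\<^sup>+a. ennreal (R a) * indicator AS a \<partial>P)"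
  proof (cases "AS = {}")
    case False
    \<comment> \<open>Only a set that really occurs as a set of read coordinates is known to have at
      most \<open>q\<close> elements, as the density requires.\<close>
    then obtain a0 where "seen act q a0 = S" by (auto simp: AS_def)
    then have card: "card S \<le> q" using card_seen[of q a0] by simp
    have finS: "finite S" using S finite_V by (rule finite_subset)
    have "\<epsilon> * card S \<le> \<epsilon> * q" using card \<epsilon>(1) by (intro mult_left_mono) auto
    then have card': "\<epsilon> * card S \<le> 1/2" using \<epsilon>(2) by linarith
    have eS: "\<And>i j. i \<in> S \<Longrightarrow> j \<in> S \<Longrightarrow> \<bar>e i j\<bar> \<le> \<epsilon>" "\<And>i j. i \<in> S \<Longrightarrow> j \<in> S \<Longrightarrow> e i j = e j i"
      "\<And>i. i \<in> S \<Longrightarrow> e i i = 0"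
      using e_le e_sym e_diag S by blast+
    from gaussian_density_exists[where e=e, OF finS \<epsilon>(1) card' eS]
    obtain K h where K: "K \<ge> 1" and h[measurable]: "h \<in> borel_measurable (PiM S (\<lambda>_. borel))"
      and hc: "\<And>a. \<exists>c. (\<forall>i\<in>S. a i = c i + (\<Sum>j\<in>S. e i j * c j)) \<and> h (restrict a S) = (\<Sum>i\<in>S. a i * c i)"
      and D: "gaussian_measure e S (density (PiM S (\<lambda>_. std_normal_distribution))
       (\<lambda>a. ennreal (K * exp (((\<Sum>i\<in>S. (a i)\<^sup>2) - h a) / 2))))"
      by blast
    define f where "f a = K * exp (((\<Sum>i\<in>S. (a i)\<^sup>2) - h a) / 2)" for a
    have [measurable]: "f \<in> borel_measurable (PiM S (\<lambda>_. borel))" unfolding f_def by measurable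
    let ?PS = "PiM S (\<lambda>_. std_normal_distribution)"
    have res[measurable]: "(\<lambda>a. restrict a S) \<in> B \<rightarrow>\<^sub>M PiM S (\<lambda>_. borel)"
      by (rule measurable_restrict_subset[OF S])
    have [measurable]: "(\<lambda>a. restrict a S) \<in> P \<rightarrow>\<^sub>M ?PS"
      by (rule measurable_restrict_subset[OF S])
    have lawQ: "distr Q (PiM S (\<lambda>_. borel)) (\<lambda>a. restrict a S) = density ?PS f"
      using gaussian_measure_unique[OF finS gaussian_measure_restrict[OF finite_V S Q] D]
      by (simp add: f_def)
    have lawP: "distr P ?PS (\<lambda>a. restrict a S) = ?PS"
    proof -
      interpret product_prob_space "\<lambda>_. std_normal_distribution" V by standard
      show ?thesis by (rule distr_PiM_restrict_finite[OF finS S])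
    qed
    txt \<open>On \<open>AS\<close> everything is determined by the coordinates in \<open>S\<close>, so any extension will do.\<close>
    define ext where "ext b = (\<lambda>v\<in>V. if v \<in> S then b v else 0 :: real)" for b
    have [measurable]: "ext \<in> PiM S (\<lambda>_. borel) \<rightarrow>\<^sub>M B"
      unfolding ext_def
    proof (rule measurable_restrict)
      fix v show "(\<lambda>b. if v \<in> S then b v else 0) \<in> borel_measurable (PiM S (\<lambda>_. borel :: real measure))"
        by (cases "v \<in> S") auto
    qed
    define A' where "A' = {b \<in> space (PiM S (\<lambda>_. borel)). ext b \<in> AS}"
    have [measurable]: "A' \<in> sets (PiM S (\<lambda>_. borel))" unfolding A'_def by measurable
    have A': "restrict a S \<in> A' \<longleftrightarrow> a \<in> AS" if a: "a \<in> space B" for a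
    proof -
      have sp: "restrict a S \<in> space (PiM S (\<lambda>_. borel))" "ext (restrict a S) \<in> space B"
        by (auto simp: space_PiM ext_def)
      have eq: "ext (restrict a S) v = a v" if "v \<in> S" for v using that S by (auto simp: ext_def)
      have "ext (restrict a S) \<in> AS" if "a \<in> AS"
      proof -
        have "seen act q a = S" "a \<in> A" using that by (auto simp: AS_def)
        then have "ext (restrict a S) \<in> A" "seen act q (ext (restrict a S)) = S"
          using A_seen[of a "ext (restrict a S)"] seen_cong[of q a "ext (restrict a S)"] sp eq by auto
        then show ?thesis by (simp add: AS_def)
      qed
      moreover have "a \<in> AS" if "ext (restrict a S) \<in> AS"
      proof -
        have "seen act q (ext (restrict a S)) = S" "ext (restrict a S) \<in> A" using that by (auto simp: AS_def)
        then have "a \<in> A" "seen act q a = S"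
          using A_seen[of "ext (restrict a S)" a] seen_cong[of q "ext (restrict a S)" a] a eq by auto
        then show ?thesis by (simp add: AS_def)
      qed
      ultimately show ?thesis using sp by (auto simp: A'_def)
    qed
    have spQ: "space Q = space B" using \<open>sets Q = sets B\<close> by (rule sets_eq_imp_space_eq)
    have "emeasure Q AS = emeasure Q ((\<lambda>a. restrict a S) -` A' \<inter> space Q)"
      using A' sets.sets_into_space[OF AS] by (intro arg_cong[where f="emeasure Q"]) (auto simp: spQ)
    also have "\<dots> = emeasure (density ?PS f) A'"
      unfolding lawQ[symmetric] by (subst emeasure_distr) auto
    also have "\<dots> = (\<integral>\<^sup>+b. ennreal (f b) * indicator A' b \<partial>?PS)"
      by (subst emeasure_density) auto
    also have "\<dots> = (\<integral>\<^sup>+a. ennreal (f (restrict a S)) * indicator A' (restrict a S) \<partial>P)"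
      by (subst lawP[symmetric], subst nn_integral_distr) auto
    also have "\<dots> = (\<integral>\<^sup>+a. ennreal (f (restrict a S)) * indicator AS a \<partial>P)"
      using A' by (intro nn_integral_cong) (auto simp: space_PiM indicator_def)
    finally have eQ: "emeasure Q AS = (\<integral>\<^sup>+a. ennreal (f (restrict a S)) * indicator AS a \<partial>P)" .
    have "emeasure P AS = (\<integral>\<^sup>+a. indicator AS a \<partial>P)" by simp
    also have "\<dots> \<le> (\<integral>\<^sup>+a. ennreal (f (restrict a S)) * indicator AS a + ennreal (R a) * indicator AS a \<partial>P)"
    proof (intro nn_integral_mono)
      fix a
      show "(indicator AS a :: ennreal) \<le> ennreal (f (restrict a S)) * indicator AS a + ennreal (R a) * indicator AS a"
      proof (cases "a \<in> AS")
        case True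
        then have SE: "seen act q a = S" by (simp add: AS_def)
        obtain c where c: "\<And>i. i \<in> S \<Longrightarrow> a i = c i + (\<Sum>j\<in>S. e i j * c j)" "h (restrict a S) = (\<Sum>i\<in>S. a i * c i)"
          using hc by blast
        \<comment> \<open>A lower bound for the exponent of the density. Since
          \<open>K \<ge> 1\<close>, it gives 1 - R \<le> 1 + x \<le> exp x \<le> f.\<close>
        define x where "x = W q a - (\<Sum>w\<in>seen act q a. (X w q a)\<^sup>2)"
        have "h (restrict a S) \<le> (\<Sum>i\<in>S. (a i)\<^sup>2) - (\<Sum>i\<in>S. \<Sum>j\<in>S. a i * a j * e i j) + 2 * (\<Sum>i\<in>S. (\<Sum>j\<in>S. e i j * a j)\<^sup>2)"
          unfolding c(2) using gram_form_coercive[OF finS \<epsilon>(1) card' eS(1)] eS(2) c(1)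
          by (rule inverse_gram_form_le)
        then have "x \<le> ((\<Sum>i\<in>S. (a i)\<^sup>2) - h (restrict a S)) / 2"
          by (simp add: x_def W_def X_def SE)
        moreover have "(\<Sum>i\<in>S. (restrict a S i)\<^sup>2) = (\<Sum>i\<in>S. (a i)\<^sup>2)" by simp
        ultimately have "exp x \<le> exp (((\<Sum>i\<in>S. (restrict a S i)\<^sup>2) - h (restrict a S)) / 2)" by simp
        also have "\<dots> \<le> f (restrict a S)"
          unfolding f_def using K mult_right_mono[of 1 K] by simp
        finally have "exp x \<le> f (restrict a S)" .
        moreover have "\<bar>x\<bar> \<le> R a"
          unfolding x_def R_def using sum_nonneg[of "seen act q a" "\<lambda>w. (X w q a)\<^sup>2"] by simp
        moreover have "1 + x \<le> exp x" by (rule exp_ge_add_one_self)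
        ultimately have "1 \<le> f (restrict a S) + R a" "0 \<le> R a"
          by linarith+
        moreover have "0 \<le> f (restrict a S)" using K by (simp add: f_def)
        ultimately show ?thesis using True by (simp flip: ennreal_plus)
      qed simp
    qed
    also have "\<dots> = emeasure Q AS + (\<integral>\<^sup>+a. ennreal (R a) * indicator AS a \<partial>P)"
      unfolding eQ by (rule nn_integral_add) measurable
    finally show ?thesis .
  qed simp
qed

text \<open>The pieces \<open>AS S\<close> are disjoint, so their errors add up to at most one
  integral of \<open>R\<close>; the number of possible sets \<open>S\<close> does not enter.\<close>

lemma emeasure_independent_le_planted:
  assumes \<epsilon>: "\<epsilon> \<ge> 0" "\<epsilon> * q \<le> 1/2" and Q: "gaussian_measure e V Q"
    and A[measurable]: "A \<in> sets B"
    and A_seen: "\<And>a b. a \<in> A \<Longrightarrow> b \<in> space B \<Longrightarrow> (\<And>v. v \<in> seen act q a \<Longrightarrow> a v = b v) \<Longrightarrow> b \<in> A"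
  shows "emeasure P A \<le> emeasure Q A + (\<integral>\<^sup>+a. R a \<partial>P)"
proof -
  define AS where "AS S = {a \<in> A. seen act q a = S}" for S
  note AS = emeasure_stopped_le[OF \<epsilon> Q A A_seen, folded AS_def]
  have setsQ: "sets Q = sets B" using Q by (auto simp: gaussian_measure_def)
  have A_eq: "A = (\<Union>S\<in>Pow V. AS S)"
    using seen_subset by (auto simp: AS_def)
  have disj: "disjoint_family_on AS (Pow V)"
    by (auto simp: disjoint_family_on_def AS_def)
  have sum: "(\<Sum>S\<in>Pow V. emeasure L (AS S)) = emeasure L A" if "sets L = sets B" for L
    unfolding A_eq using finite_V disj AS(1) that by (intro sum_emeasure) auto
  have ind: "(\<Sum>S\<in>Pow V. ennreal (R a) * indicator (AS S) a) \<le> ennreal (R a)" for a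
  proof -
    have "(\<Sum>S\<in>Pow V. ennreal (R a) * indicator (AS S) a) = ennreal (R a) * (\<Sum>S\<in>Pow V. indicator (AS S) a)"
      by (simp add: sum_distrib_left)
    also have "(\<Sum>S\<in>Pow V. indicator (AS S) a) = (indicator A a :: ennreal)"
      unfolding A_eq using finite_V disj by (intro indicator_UN_disjoint[symmetric]) auto
    also have "ennreal (R a) * indicator A a \<le> ennreal (R a)" by (simp add: indicator_def)
    finally show ?thesis .
  qed
  have "emeasure P A = (\<Sum>S\<in>Pow V. emeasure P (AS S))" by (subst sum) (simp_all add: sets_PiM_std_normal)
  also have "\<dots> \<le> (\<Sum>S\<in>Pow V. emeasure Q (AS S) + (\<integral>\<^sup>+a. ennreal (R a) * indicator (AS S) a \<partial>P))"
    using AS(2) by (intro sum_mono) auto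
  also have "\<dots> = emeasure Q A + (\<Sum>S\<in>Pow V. \<integral>\<^sup>+a. ennreal (R a) * indicator (AS S) a \<partial>P)"
    using sum[OF setsQ] by (simp add: sum.distrib)
  also have "(\<Sum>S\<in>Pow V. \<integral>\<^sup>+a. ennreal (R a) * indicator (AS S) a \<partial>P) = (\<integral>\<^sup>+a. (\<Sum>S\<in>Pow V. ennreal (R a) * indicator (AS S) a) \<partial>P)"
  proof (rule nn_integral_sum[symmetric])
    fix S assume "S \<in> Pow V"
    then have [measurable]: "AS S \<in> sets B" using AS(1) by auto
    show "(\<lambda>a. ennreal (R a) * indicator (AS S) a) \<in> borel_measurable P" by measurable
  qed
  also have "\<dots> \<le> (\<integral>\<^sup>+a. R a \<partial>P)"
    using ind by (intro nn_integral_mono)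
  finally show ?thesis by (simp add: add_left_mono)
qed

text \<open>The reverse inequality is the one-sided comparison applied to the complement, which is
  determined by the same readings, combined with both laws having mass one.\<close>

theorem emeasure_indistinguishable:
  assumes \<epsilon>: "\<epsilon> \<ge> 0" "\<epsilon> * q \<le> 1/2" and Q: "gaussian_measure e V Q" and \<theta>: "\<theta> > 0"
    and A[measurable]: "A \<in> sets B"
    and A_seen: "\<And>a b. a \<in> space B \<Longrightarrow> b \<in> space B \<Longrightarrow> (\<And>v. v \<in> seen act q a \<Longrightarrow> a v = b v) \<Longrightarrow> a \<in> A \<longleftrightarrow> b \<in> A"
  defines "\<eta> \<equiv> \<theta> / 2 + q * \<beta> / (2 * \<theta>) + q * \<beta>"
  shows "emeasure P A \<le> emeasure Q A + \<eta>" and "emeasure Q A \<le> emeasure P A + \<eta>"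
proof -
  interpret P: prob_space P by (rule prob_space_P)
  interpret Q: prob_space Q using Q by (simp add: gaussian_measure_def)
  have setsQ: "sets Q = sets B" using Q by (auto simp: gaussian_measure_def)
  have sp: "space Q = space B" "space P = space B"
    using sets_eq_imp_space_eq[OF setsQ] by (auto simp: space_PiM)
  have \<eta>: "0 \<le> \<eta>" using \<theta> \<beta>_nonneg by (simp add: \<eta>_def)
  have R: "(\<integral>\<^sup>+a. R a \<partial>P) \<le> ennreal \<eta>"
    using log_likelihood_moment[OF \<theta>] by (simp add: R_def \<eta>_def)
  have A_space: "A \<subseteq> space B" using sets.sets_into_space[OF A] .
  have "emeasure P A \<le> emeasure Q A + (\<integral>\<^sup>+a. R a \<partial>P)"
    using A_seen A_space by (intro emeasure_independent_le_planted[OF \<epsilon> Q A]) blast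
  also have "\<dots> \<le> emeasure Q A + \<eta>" using R by (intro add_left_mono)
  finally show "emeasure P A \<le> emeasure Q A + \<eta>" .
  have "emeasure P (space B - A) \<le> emeasure Q (space B - A) + (\<integral>\<^sup>+a. R a \<partial>P)"
  proof (rule emeasure_independent_le_planted[OF \<epsilon> Q])
    show "b \<in> space B - A" if "a \<in> space B - A" "b \<in> space B" "\<And>v. v \<in> seen act q a \<Longrightarrow> a v = b v" for a b
      using A_seen[of a b] that by blast
  qed simp
  also have "\<dots> \<le> emeasure Q (space B - A) + \<eta>" using R by (intro add_left_mono)
  finally have "measure P (space B - A) \<le> measure Q (space B - A) + \<eta>"
    using \<eta> by (simp add: P.emeasure_eq_measure Q.emeasure_eq_measure flip: ennreal_plus)
  moreover have "measure P (space B - A) = 1 - measure P A" "measure Q (space B - A) = 1 - measure Q A"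
    using P.prob_compl[of A] Q.prob_compl[of A] A by (simp_all add: sp setsQ sets_PiM_std_normal)
  ultimately show "emeasure Q A \<le> emeasure P A + \<eta>"
    using \<eta> by (simp add: P.emeasure_eq_measure Q.emeasure_eq_measure flip: ennreal_plus)
qed

end

section \<open>Query algorithms\<close>

text \<open>The list is padded with 0 after the algorithm has stopped. It thus always has length
  \<open>n\<close>, as the measurability condition of \<open>randomized_alg\<close> expects, and
  \<open>next_action\<close> ignores the padding.\<close>

fun responses :: "query_alg \<Rightarrow> nat \<Rightarrow> (real Matrix.vec \<Rightarrow> real) \<Rightarrow> real list" where
  "responses t 0 a = []"
| "responses t (Suc n) a = responses t n a @
     [case next_action t (responses t n a) of Inl v \<Rightarrow> a v | Inr b \<Rightarrow> 0]"

definition query_at :: "query_alg \<Rightarrow> nat \<Rightarrow> (real Matrix.vec \<Rightarrow> real) \<Rightarrow> real Matrix.vec option" where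
  "query_at t n a = (case next_action t (responses t n a) of Inl v \<Rightarrow> Some v | Inr b \<Rightarrow> None)"

lemma query_at_Some_iff: "query_at t n a = Some v \<longleftrightarrow> next_action t (responses t n a) = Inl v"
  by (auto simp: query_at_def split: sum.splits)

text \<open>The list grows at its end, whereas a query tree is taken apart at its root; this
  reconciles the two for inductions over the tree.\<close>

lemma responses_Query:
  "responses (Query v k) (Suc n) a = a v # responses (k (a v)) n a"
proof (induction n)
  case (Suc n)
  then show ?case
    using responses.simps(2)[of "Query v k" "Suc n" a] by (simp del: responses.simps(2)) (simp add: responses.simps(2)[of "k (a v)"])
qed simp

lemma query_at_Query_0: "query_at (Query v k) 0 a = Some v"
  by (simp add: query_at_def)

lemma query_at_Query_Suc: "query_at (Query v k) (Suc n) a = query_at (k (a v)) n a"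
  by (simp add: query_at_def responses_Query del: responses.simps(2))

lemma query_at_fresh:
  assumes "fresh_queries t U" "query_at t n a = Some v"
  shows "v \<in> U" and "v \<notin> seen (query_at t) n a"
proof -
  have "v \<in> U \<and> (\<forall>i<n. query_at t i a \<noteq> Some v)"
    using assms
  proof (induction t arbitrary: U n)
    case (Output b)
    then show ?case by (simp add: query_at_def)
  next
    case (Query u k)
    show ?case
    proof (cases n)
      case 0
      then show ?thesis using Query.prems by (simp add: query_at_Query_0)
    next
      case (Suc m)
      then have "query_at (k (a u)) m a = Some v" "fresh_queries (k (a u)) (U - {u})"
        using Query.prems by (auto simp: query_at_Query_Suc)
      with Query.IH[of "k (a u)" "U - {u}" m]
      have IH: "v \<in> U - {u}" "\<forall>i<m. query_at (k (a u)) i a \<noteq> Some v" by auto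
      have "query_at (Query u k) i a \<noteq> Some v" if "i < n" for i
        using IH that Suc by (cases i) (auto simp: query_at_Query_0 query_at_Query_Suc)
      then show ?thesis using IH by auto
    qed
  qed
  then show "v \<in> U" "v \<notin> seen (query_at t) n a" by (auto simp: seen_def)
qed

lemma responses_cong:
  assumes "\<And>v. v \<in> seen (query_at t) n a \<Longrightarrow> a v = b v"
  shows "responses t n a = responses t n b"
  using assms
proof (induction n)
  case (Suc n)
  have "responses t n a = responses t n b"
    using Suc.prems by (intro Suc.IH) (auto simp: seen_def intro: less_SucI)
  moreover have "a v = b v" if "next_action t (responses t n a) = Inl v" for v
    using that by (intro Suc.prems) (auto simp: seen_def query_at_Some_iff)
  ultimately show ?case by (auto split: sum.splits)
qed simp

text \<open>Makes acceptance visible after exactly \<open>n\<close> rounds, however early the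
  algorithm stops. Acceptance thereby becomes a measurable event.\<close>

lemma next_action_stopped:
  "num_queries t a \<le> n \<Longrightarrow> next_action t (responses t n a) = Inr (accepts t a)"
proof (induction t arbitrary: n)
  case (Query v k)
  then obtain m where n: "n = Suc m" by (cases n) auto
  show ?case
    using Query.IH[of "k (a v)" m] Query.prems unfolding n
    by (simp add: responses_Query del: responses.simps(2))
qed simp

lemma responses_conv_map:
  "responses t n a = map (\<lambda>i. responses t (Suc i) a ! i) [0..<n]"
proof -
  have len: "length (responses t n a) = n" for n by (induction n) auto
  have "responses t n a ! i = responses t (Suc i) a ! i" if "i < n" for i
    using that
  proof (induction n)
    case (Suc n)
    then show ?case
      by (cases "i = n") (auto simp: nth_append len)
  qed simp
  then show ?thesis by (intro nth_equalityI) (auto simp: len)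
qed

text \<open>Strong induction on the round: response \<open>i\<close> is a finite sum of coordinates
  cut off by the events that action \<open>i\<close> queries them, so measurable earlier actions
  give a measurable response list, to which \<open>meas\<close> applies.\<close>

lemma measurable_next_action:
  assumes V: "finite V" "fresh_queries t V"
    and meas: "\<And>n. (\<lambda>x. next_action t (map x [0..<n])) \<in> PiM {..<n} (\<lambda>_. borel) \<rightarrow>\<^sub>M count_space UNIV"
  shows "(\<lambda>a. next_action t (responses t n a)) \<in> PiM V (\<lambda>_. borel) \<rightarrow>\<^sub>M count_space UNIV"
proof (induction n rule: less_induct)
  case (less n)
  define r where "r i a = responses t (Suc i) a ! i" for i a
  have len: "length (responses t n a) = n" for n a by (induction n) auto
  have r: "r i a = (\<Sum>v\<in>V. if next_action t (responses t i a) = Inl v then a v else 0)" for i a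
  proof (cases "next_action t (responses t i a)")
    case (Inl u)
    then have "u \<in> V" using query_at_fresh(1)[OF V(2)] query_at_Some_iff by blast
    then have "(\<Sum>v\<in>V. if Inl u = Inl v then a v else 0) = a u"
      using V(1) by (simp add: sum.delta)
    then show ?thesis using Inl by (simp add: r_def nth_append len)
  qed (simp add: r_def nth_append len)
  have rm: "r i \<in> borel_measurable (PiM V (\<lambda>_. borel))" if "i < n" for i
  proof -
    note [measurable] = less.IH[OF that]
    show ?thesis unfolding r by measurable
  qed
  have "(\<lambda>a. \<lambda>i\<in>{..<n}. r i a) \<in> PiM V (\<lambda>_. borel) \<rightarrow>\<^sub>M PiM {..<n} (\<lambda>_. borel)"
    using rm by (intro measurable_restrict) auto
  from measurable_compose[OF this meas[of n]]
  have "(\<lambda>a. next_action t (map (\<lambda>i\<in>{..<n}. r i a) [0..<n])) \<in> PiM V (\<lambda>_. borel) \<rightarrow>\<^sub>M count_space UNIV" .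
  also have "(\<lambda>a. next_action t (map (\<lambda>i\<in>{..<n}. r i a) [0..<n])) = (\<lambda>a. next_action t (responses t n a))"
  proof
    fix a
    have "map (\<lambda>i\<in>{..<n}. r i a) [0..<n] = map (\<lambda>i. r i a) [0..<n]" by (intro map_cong) auto
    also have "\<dots> = responses t n a" unfolding r_def by (rule responses_conv_map[symmetric])
    finally show "next_action t (map (\<lambda>i\<in>{..<n}. r i a) [0..<n]) = next_action t (responses t n a)" by simp
  qed
  finally show ?case .
qed

lemma exploration_query_at:
  assumes V: "finite V" "fresh_queries t V"
    and meas: "\<And>n. (\<lambda>x. next_action t (map x [0..<n])) \<in> PiM {..<n} (\<lambda>_. borel) \<rightarrow>\<^sub>M count_space UNIV"
  shows "exploration V (query_at t)"
proof
  show "Measurable.pred (PiM V (\<lambda>_. borel)) (\<lambda>a. query_at t n a = Some v)" for n v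
  proof -
    note [measurable] = measurable_next_action[OF V meas, of n]
    show ?thesis unfolding query_at_Some_iff by measurable
  qed
  show "query_at t n a = query_at t n b" if "\<And>v. v \<in> seen (query_at t) n a \<Longrightarrow> a v = b v" for n a b
    using responses_cong[OF that] by (simp add: query_at_def)
qed (use V query_at_fresh in auto)

section \<open>The planted law as a Gaussian law\<close>

definition off_diagonal :: "real Matrix.vec \<Rightarrow> real Matrix.vec \<Rightarrow> real" where
  "off_diagonal v w = (if v = w then 0 else scalar_prod v w)"

lemma sets_planted_responses: "sets (planted_responses N V) = sets (PiM V (\<lambda>_. borel))"
  by (simp add: planted_responses_def)

text \<open>The characteristic function factorises over the coordinates of \<open>\<psi>\<close>,
  with frequency vector y = \<Sum> t v * v. Its squared length is the Gram form, and unit length of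
  the test vectors puts ones on the diagonal.\<close>

lemma gaussian_measure_planted:
  assumes V: "finite V" "V \<subseteq> unit_vectors N"
  shows "gaussian_measure off_diagonal V (planted_responses N V)"
proof -
  let ?G = "PiM {..<N} (\<lambda>_. std_normal_distribution) :: (nat \<Rightarrow> real) measure"
  let ?f = "\<lambda>\<psi>. \<lambda>v\<in>V. scalar_prod (Matrix.vec N \<psi>) v"
  have dim: "dim_vec v = N" and unit: "scalar_prod v v = 1" if "v \<in> V" for v
    using that V by (auto simp: unit_vectors_def)
  have sp: "scalar_prod (Matrix.vec N \<psi>) v = (\<Sum>i<N. \<psi> i * vec_index v i)" if "v \<in> V" for v \<psi>
    using dim[OF that] by (simp add: scalar_prod_def atLeast0LessThan)
  have [measurable]: "?f \<in> ?G \<rightarrow>\<^sub>M PiM V (\<lambda>_. borel)"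
  proof (rule measurable_restrict)
    fix v assume v: "v \<in> V"
    have "(\<lambda>\<psi>. \<Sum>i<N. \<psi> i * vec_index v i) \<in> borel_measurable ?G" by measurable
    then show "(\<lambda>\<psi>. scalar_prod (Matrix.vec N \<psi>) v) \<in> borel_measurable ?G" by (simp add: sp[OF v])
  qed
  have "prob_space ?G" by (intro prob_space_PiM std_normal.prob_space_axioms)
  then have "prob_space (planted_responses N V)"
    unfolding planted_responses_def by (rule prob_space.prob_space_distr) simp
  moreover have "(CLINT x|planted_responses N V. iexp (\<Sum>v\<in>V. t v * x v)) = exp (- gram_form off_diagonal V t / 2)" for t :: "real Matrix.vec \<Rightarrow> real"
  proof -
    define y where "y i = (\<Sum>v\<in>V. t v * vec_index v i)" for i
    have lin: "(\<Sum>v\<in>V. t v * ?f \<psi> v) = (\<Sum>i<N. y i * \<psi> i)" for \<psi>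
    proof -
      have "(\<Sum>v\<in>V. t v * ?f \<psi> v) = (\<Sum>v\<in>V. \<Sum>i<N. t v * vec_index v i * \<psi> i)"
        by (intro sum.cong refl) (simp add: sp sum_distrib_left mult_ac)
      also have "\<dots> = (\<Sum>i<N. y i * \<psi> i)"
        by (subst sum.swap) (simp add: y_def sum_distrib_right)
      finally show ?thesis .
    qed
    have yy: "(\<Sum>i<N. (y i)\<^sup>2) = gram_form off_diagonal V t"
    proof -
      have "(\<Sum>i<N. (y i)\<^sup>2) = (\<Sum>i<N. \<Sum>v\<in>V. \<Sum>w\<in>V. t v * t w * (vec_index v i * vec_index w i))"
        by (simp add: y_def power2_eq_square sum_product mult_ac)
      also have "\<dots> = (\<Sum>v\<in>V. \<Sum>w\<in>V. \<Sum>i<N. t v * t w * (vec_index v i * vec_index w i))"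
        by (subst sum.swap, intro sum.cong refl, rule sum.swap)
      also have "\<dots> = (\<Sum>v\<in>V. \<Sum>w\<in>V. t v * t w * scalar_prod v w)"
        by (intro sum.cong refl) (simp add: scalar_prod_def dim sum_distrib_left atLeast0LessThan)
      also have "\<dots> = (\<Sum>v\<in>V. \<Sum>w\<in>V. (if v = w then (t v)\<^sup>2 else 0) + t v * t w * off_diagonal v w)"
        by (intro sum.cong refl) (auto simp: off_diagonal_def unit power2_eq_square)
      also have "\<dots> = gram_form off_diagonal V t"
        using V(1) by (simp add: gram_form_def sum.distrib)
      finally show ?thesis .
    qed
    have int: "integrable std_normal_distribution (\<lambda>x. iexp (s * x))" for s
      by (rule std_normal.integrable_iexp) auto
    have "(CLINT x|planted_responses N V. iexp (\<Sum>v\<in>V. t v * x v)) = (CLINT \<psi>|?G. iexp (\<Sum>v\<in>V. t v * ?f \<psi> v))"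
      unfolding planted_responses_def by (subst integral_distr) auto
    also have "\<dots> = (CLINT \<psi>|?G. (\<Prod>i<N. iexp (y i * \<psi> i)))"
      unfolding lin by (simp add: exp_sum sum_distrib_left)
    also have "\<dots> = (\<Prod>i<N. char std_normal_distribution (y i))"
      unfolding char_def using int by (intro std_normals.product_integral_prod) auto
    also have "\<dots> = of_real (exp (\<Sum>i<N. - (y i)\<^sup>2 / 2))"
      by (simp add: char_std_normal_distribution exp_sum)
    also have "(\<Sum>i<N. - (y i)\<^sup>2 / 2) = - gram_form off_diagonal V t / 2"
      unfolding yy[symmetric] by (simp add: sum_negf sum_divide_distrib)
    finally show ?thesis .
  qed
  ultimately show ?thesis
    by (simp add: gaussian_measure_def sets_planted_responses)
qed

section \<open>Bias bounds for deterministic and randomized algorithms\<close>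

lemma deterministic_bias:
  fixes \<epsilon> \<theta> :: real and q M :: nat
  assumes V: "finite V" "V \<subseteq> unit_vectors N" "card V \<le> M" and M: "M \<ge> 1"
    and \<epsilon>: "\<epsilon> > 0" "\<epsilon> * q \<le> 1/2" and \<theta>: "\<theta> > 0"
    and corr: "\<And>v w. v \<in> V \<Longrightarrow> w \<in> V \<Longrightarrow> v \<noteq> w \<Longrightarrow> \<bar>scalar_prod v w\<bar> \<le> \<epsilon>"
    and fresh: "fresh_queries t V"
    and meas: "\<And>n. (\<lambda>x. next_action t (map x [0..<n])) \<in> PiM {..<n} (\<lambda>_. borel) \<rightarrow>\<^sub>M count_space UNIV"
    and q: "\<And>a. num_queries t a \<le> q"
  defines "A \<equiv> {a \<in> space (PiM V (\<lambda>_. borel)). accepts t a}"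
    and "\<eta> \<equiv> \<theta> / 2 + (1 / (2 * \<theta>) + 1) * ((\<epsilon> * q)\<^sup>2 * (2 * (ln M)\<^sup>2 + 16))"
  shows "emeasure (independent_responses V) A \<le> emeasure (planted_responses N V) A + \<eta>"
    and "emeasure (planted_responses N V) A \<le> emeasure (independent_responses V) A + \<eta>"
proof -
  \<comment> \<open>For positive \<open>q\<close> this saturates
    \<open>q * (s\<^sup>2 * \<epsilon>\<^sup>2) \<le> 1\<close>, which makes \<open>\<beta>\<close>
    smallest. For \<open>q = 0\<close> any positive value would do.\<close>
  define s where "s = (if q = 0 then 1 else 1 / (\<epsilon> * sqrt q))"
  have s: "s > 0" using \<epsilon> by (simp add: s_def)
  have s2: "q * (s\<^sup>2 * \<epsilon>\<^sup>2) \<le> 1" "real q / s\<^sup>2 = (\<epsilon> * q)\<^sup>2"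
    using \<epsilon> by (auto simp: s_def power_divide power_mult_distrib power2_eq_square[of "real q"])
  interpret exploration V "query_at t"
    by (rule exploration_query_at[OF V(1) fresh meas])
  interpret bounded_exploration V "query_at t" off_diagonal \<epsilon> q M s
  proof
    show "\<bar>off_diagonal u v\<bar> \<le> \<epsilon>" if "u \<in> V" "v \<in> V" for u v
      using corr[OF that] \<epsilon> by (auto simp: off_diagonal_def)
    show "off_diagonal u v = off_diagonal v u" if "u \<in> V" "v \<in> V" for u v
      using that V(2) by (auto simp: off_diagonal_def unit_vectors_def intro: comm_scalar_prod)
  qed (use V M s s2 in \<open>auto simp: off_diagonal_def\<close>)
  have stop: "next_action t (responses t q a) = Inr (accepts t a)" for a
    using q by (rule next_action_stopped)
  have "A = {a \<in> space B. next_action t (responses t q a) = Inr True}"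
    by (auto simp: A_def stop)
  moreover note [measurable] = measurable_next_action[OF V(1) fresh meas, of q]
  ultimately have A: "A \<in> sets B" by simp
  have A_seen: "a \<in> A \<longleftrightarrow> b \<in> A"
    if "a \<in> space B" "b \<in> space B" "\<And>v. v \<in> seen (query_at t) q a \<Longrightarrow> a v = b v" for a b
    using stop[of a] stop[of b] responses_cong[OF that(3)] that(1,2) by (auto simp: A_def)
  have "q * \<beta> = (\<epsilon> * q)\<^sup>2 * (2 * (ln M)\<^sup>2 + 16)"
    unfolding s2(2)[symmetric] \<beta>_def by simp
  moreover have "\<theta> / 2 + y / (2 * \<theta>) + y = \<theta> / 2 + (1 / (2 * \<theta>) + 1) * y" for y
    by (simp add: distrib_right)
  ultimately have \<eta>: "\<theta> / 2 + q * \<beta> / (2 * \<theta>) + q * \<beta> = \<eta>"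
    by (simp only: \<eta>_def)
  note ind = emeasure_indistinguishable[OF less_imp_le[OF \<epsilon>(1)] \<epsilon>(2) gaussian_measure_planted[OF V(1,2)] \<theta> A A_seen, unfolded \<eta>]
  show "emeasure (independent_responses V) A \<le> emeasure (planted_responses N V) A + \<eta>"
    "emeasure (planted_responses N V) A \<le> emeasure (independent_responses V) A + \<eta>"
    unfolding independent_responses_def by (rule ind; assumption)+
qed

lemma prob_space_responses:
  assumes "finite V" "V \<subseteq> unit_vectors N"
  shows "prob_space (independent_responses V)" "prob_space (planted_responses N V)"
  using gaussian_measure_planted[OF assms]
  by (auto simp: independent_responses_def gaussian_measure_def intro!: prob_space_PiM std_normal.prob_space_axioms)

text \<open>Given the seed the algorithm is deterministic, and an additive error that is uniform in
  the seed survives averaging by Fubini's theorem.\<close>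

lemma accept_prob_le:
  assumes R: "prob_space R" and D: "prob_space D1" "prob_space D2"
    and sets: "sets D1 = sets D2" and \<eta>: "\<eta> \<ge> 0"
    and le: "\<And>r. r \<in> space R \<Longrightarrow>
      emeasure D1 {a \<in> space D1. accepts (T r) a} \<le> emeasure D2 {a \<in> space D1. accepts (T r) a} + ennreal \<eta>"
  shows "accept_prob R T D1 \<le> accept_prob R T D2 + \<eta>"
proof -
  interpret R: prob_space R by fact
  interpret D1: prob_space D1 by fact
  interpret D2: prob_space D2 by fact
  interpret P1: pair_prob_space R D1 by standard
  interpret P2: pair_prob_space R D2 by standard
  have sp: "space D1 = space D2" using sets by (rule sets_eq_imp_space_eq)
  have pair: "sets (R \<Otimes>\<^sub>M D1) = sets (R \<Otimes>\<^sub>M D2)" "space (R \<Otimes>\<^sub>M D1) = space (R \<Otimes>\<^sub>M D2)"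
    using sets sp by (auto simp: space_pair_measure cong: sets_pair_measure_cong)
  define E where "E = {(r, a) \<in> space (R \<Otimes>\<^sub>M D1). accepts (T r) a}"
  have E2: "E = {(r, a) \<in> space (R \<Otimes>\<^sub>M D2). accepts (T r) a}"
    by (simp add: E_def pair)
  show ?thesis
  proof (cases "E \<in> sets (R \<Otimes>\<^sub>M D1)")
    case False
    txt \<open>A non-measurable acceptance event gets measure \<open>0\<close> in both cases.\<close>
    then show ?thesis
      using pair(1) \<eta> E_def E2 by (simp add: accept_prob_def measure_notin_sets)
  next
    case E: True
    have slice: "Pair r -` E = {a \<in> space D1. accepts (T r) a}" if "r \<in> space R" for r
      using that by (auto simp: E_def space_pair_measure)
    have "emeasure (R \<Otimes>\<^sub>M D1) E = (\<integral>\<^sup>+r. emeasure D1 (Pair r -` E) \<partial>R)"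
      by (rule D1.emeasure_pair_measure_alt[OF E])
    also have "\<dots> \<le> (\<integral>\<^sup>+r. emeasure D2 (Pair r -` E) + ennreal \<eta> \<partial>R)"
      using le by (intro nn_integral_mono) (simp add: slice)
    also have "\<dots> = (\<integral>\<^sup>+r. emeasure D2 (Pair r -` E) \<partial>R) + ennreal \<eta>"
      using D2.measurable_emeasure_Pair[of E R] E pair R.emeasure_space_1
      by (subst nn_integral_add) auto
    also have "(\<integral>\<^sup>+r. emeasure D2 (Pair r -` E) \<partial>R) = emeasure (R \<Otimes>\<^sub>M D2) E"
      using E pair by (intro D2.emeasure_pair_measure_alt[symmetric]) simp
    finally have "measure (R \<Otimes>\<^sub>M D1) E \<le> measure (R \<Otimes>\<^sub>M D2) E + \<eta>"
      using \<eta> by (simp add: P1.emeasure_eq_measure P2.emeasure_eq_measure flip: ennreal_plus)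
    then show ?thesis
      unfolding accept_prob_def E2[symmetric] E_def[symmetric] .
  qed
qed

proposition randomized_bias:
  fixes \<epsilon> \<theta> :: real and q M :: nat
  assumes V: "finite V" "V \<subseteq> unit_vectors N" "card V \<le> M" and M: "M \<ge> 1"
    and \<epsilon>: "\<epsilon> > 0" "\<epsilon> * q \<le> 1/2" and \<theta>: "\<theta> > 0"
    and corr: "\<And>v w. v \<in> V \<Longrightarrow> w \<in> V \<Longrightarrow> v \<noteq> w \<Longrightarrow> \<bar>scalar_prod v w\<bar> \<le> \<epsilon>"
    and alg: "randomized_alg V R T" and q: "makes_at_most R T q"
  shows "\<bar>accept_prob R T (independent_responses V) - accept_prob R T (planted_responses N V)\<bar>
    \<le> \<theta> / 2 + (1 / (2 * \<theta>) + 1) * ((\<epsilon> * q)\<^sup>2 * (2 * (ln M)\<^sup>2 + 16))" (is "_ \<le> ?\<eta>")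
proof -
  have R: "prob_space R" and fresh: "\<And>r. r \<in> space R \<Longrightarrow> fresh_queries (T r) V"
    and meas: "\<And>n. (\<lambda>(r, x). next_action (T r) (map x [0..<n])) \<in> R \<Otimes>\<^sub>M PiM {..<n} (\<lambda>_. borel) \<rightarrow>\<^sub>M count_space UNIV"
    using alg by (auto simp: randomized_alg_def)
  have m: "(\<lambda>x. next_action (T r) (map x [0..<n])) \<in> PiM {..<n} (\<lambda>_. borel) \<rightarrow>\<^sub>M count_space UNIV" if "r \<in> space R" for r n
    using measurable_compose[OF measurable_Pair1'[OF that] meas[of n]] by simp
  have \<eta>: "?\<eta> \<ge> 0" using \<theta> by simp
  have sets: "sets (independent_responses V) = sets (PiM V (\<lambda>_. borel))"
    by (simp add: independent_responses_def sets_PiM_std_normal)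
  have sp: "space (independent_responses V) = space (PiM V (\<lambda>_. borel))"
    "space (planted_responses N V) = space (PiM V (\<lambda>_. borel))"
    using sets_eq_imp_space_eq[OF sets] sets_eq_imp_space_eq[OF sets_planted_responses] by auto
  note D = prob_space_responses[OF V(1,2)]
  have qr: "num_queries (T r) a \<le> q" if "r \<in> space R" for r a
    using q that by (simp add: makes_at_most_def)
  note bias = deterministic_bias[OF V M \<epsilon> \<theta> corr fresh m qr]
  have "accept_prob R T (independent_responses V) \<le> accept_prob R T (planted_responses N V) + ?\<eta>"
    using bias(1) by (intro accept_prob_le[OF R D _ \<eta>]) (auto simp: sp sets sets_planted_responses)
  moreover have "accept_prob R T (planted_responses N V) \<le> accept_prob R T (independent_responses V) + ?\<eta>"
    using bias(2) by (intro accept_prob_le[OF R D(2,1) _ \<eta>]) (auto simp: sp sets sets_planted_responses)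
  ultimately show ?thesis by linarith
qed

section \<open>The query lower bound and the choice of its constant\<close>

theorem theorem2:
  fixes \<delta> :: real
  assumes "\<delta> > 0"
  shows "\<exists>c>0. \<forall>(N::nat) (M::nat) (\<epsilon>::real) V R T (q::nat).
           0 < \<epsilon> \<and> \<epsilon> \<le> 1 \<and>
           finite V \<and> V \<subseteq> unit_vectors N \<and> card V \<le> M \<and>
           (\<forall>v\<in>V. \<forall>w\<in>V. v \<noteq> w \<longrightarrow> \<bar>scalar_prod v w\<bar> \<le> \<epsilon>) \<and>
           randomized_alg V R T \<and> distinguishes_with_bias N V R T \<delta> \<and>
           makes_at_most R T q
           \<longrightarrow> real q \<ge> c * ((1 / \<epsilon>) / ln (real M / \<epsilon>))"
proof -
  \<comment> \<open>The factor \<open>1 / (2 * \<theta>) + 1\<close> of the bias bound at \<theta> =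
    \<delta>.\<close>
  define \<kappa> where "\<kappa> = 1 / (2 * \<delta>) + 1"
  \<comment> \<open>The bound 1/4 will force \<epsilon> q \<le> 3/8, and the other one makes 38
    \<kappa> c^2 \<le> 38 \<delta> / 160 < \<delta> / 2; the number 160 leaves slack.\<close>
  define c where "c = min (1/4) (\<delta> / (160 * \<kappa>))"
  have \<kappa>: "\<kappa> > 0" using assms by (simp add: \<kappa>_def add_pos_pos)
  have c: "c > 0" "c \<le> 1/4" using assms \<kappa> by (auto simp: c_def)
  have "c * (160 * \<kappa>) \<le> \<delta>"
    using \<kappa> by (simp add: c_def min_def field_simps)
  moreover have "c\<^sup>2 \<le> c * 1" unfolding power2_eq_square using c by (intro mult_left_mono) auto
  then have "\<kappa> * c\<^sup>2 \<le> \<kappa> * c" using \<kappa> by (intro mult_left_mono) auto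
  ultimately have \<kappa>c: "\<kappa> * (38 * c\<^sup>2) < \<delta> / 2" using assms by (simp add: mult_ac)
  show ?thesis
  proof (intro exI[of _ c] conjI allI impI, fact c(1), elim conjE)
    fix N M :: nat and \<epsilon> :: real and V R T and q :: nat
    assume \<epsilon>: "0 < \<epsilon>" "\<epsilon> \<le> 1" and V: "finite V" "V \<subseteq> unit_vectors N" "card V \<le> M"
      and corr: "\<forall>v\<in>V. \<forall>w\<in>V. v \<noteq> w \<longrightarrow> \<bar>scalar_prod v w\<bar> \<le> \<epsilon>"
      and alg: "randomized_alg V R T" "makes_at_most R T q"
      and dist: "distinguishes_with_bias N V R T \<delta>"
    have not_small: "\<not> (\<kappa> * ((\<epsilon>' * q)\<^sup>2 * (2 * (ln M)\<^sup>2 + 16)) < \<delta> / 2)"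
      if "M \<ge> 1" "\<epsilon>' > 0" "\<epsilon>' * q \<le> 1/2" "\<And>v w. v \<in> V \<Longrightarrow> w \<in> V \<Longrightarrow> v \<noteq> w \<Longrightarrow> \<bar>scalar_prod v w\<bar> \<le> \<epsilon>'" for \<epsilon>' :: real
      using randomized_bias[OF V that(1-3) assms that(4) alg, folded \<kappa>_def] dist
      unfolding distinguishes_with_bias_def by linarith
    consider "M = 0" | "M = 1" | "M \<ge> 2" by linarith
    then show "real q \<ge> c * ((1 / \<epsilon>) / ln (real M / \<epsilon>))"
    proof cases
      case 1
      \<comment> \<open>Here \<open>ln 0 = 0\<close> and division by zero gives 0, so the claimed
        bound is 0.\<close>
      then show ?thesis by simp
    next
      case 2
      \<comment> \<open>For \<open>M = 1\<close> the logarithm may be close to 0 or equal to 0 and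
        cannot absorb constants. Instead, the assumed bias is refuted for every
        \<open>q\<close>.\<close>
      have single: "v = w" if "v \<in> V" "w \<in> V" for v w
        using card_le_Suc0_iff_eq[OF V(1)] V(3) 2 that by auto
      txt \<open>The correlation hypothesis is vacuous here, so it also holds for an arbitrarily small \<open>\<epsilon>'\<close>.\<close>
      define \<epsilon>' where "\<epsilon>' = c / (q + 1)"
      have "\<epsilon>' > 0" "\<epsilon>' * q \<le> c" "0 \<le> \<epsilon>' * q" using c by (auto simp: \<epsilon>'_def field_simps)
      then have "(\<epsilon>' * q)\<^sup>2 * 16 \<le> 38 * c\<^sup>2"
        using power_mono[of "\<epsilon>' * q" c 2] by (simp add: mult.commute[of _ 16]) (smt (verit) zero_le_power2)
      then have "\<kappa> * ((\<epsilon>' * q)\<^sup>2 * 16) \<le> \<kappa> * (38 * c\<^sup>2)"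
        using \<kappa> by (intro mult_left_mono) auto
      with \<kappa>c have "\<kappa> * ((\<epsilon>' * q)\<^sup>2 * 16) < \<delta> / 2" by linarith
      moreover have "\<not> \<kappa> * ((\<epsilon>' * q)\<^sup>2 * 16) < \<delta> / 2"
        using not_small[of \<epsilon>'] 2 \<open>\<epsilon>' > 0\<close> \<open>\<epsilon>' * q \<le> c\<close> c single by auto
      ultimately show ?thesis by blast
    next
      case 3
      define L where "L = ln (M / \<epsilon>)"
      \<comment> \<open>Uses \<epsilon> \<le> 1; together with ln 2 \<ge> 2/3 it provides the lower
        bound on \<open>L\<close> that absorbs constants.\<close>
      have "ln (real M) \<le> L" "0 \<le> ln (real M)"
        using 3 \<epsilon> by (auto simp: L_def ln_div)
      moreover have "ln 2 \<le> ln (real M)" using 3 by simp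
      ultimately have L: "2/3 \<le> L" "(ln M)\<^sup>2 \<le> L\<^sup>2"
        using ln2_ge_two_thirds by (auto intro: power_mono)
      have "4/9 \<le> L\<^sup>2" using power_mono[OF L(1), of 2] by (simp add: power2_eq_square)
      show ?thesis
      proof (rule ccontr)
        assume "\<not> ?thesis"
        then have "q < c * ((1 / \<epsilon>) / L)" by (simp add: L_def)
        then have small: "\<epsilon> * q * L < c" using \<epsilon> L by (simp add: field_simps)
        have "\<epsilon> * q * (2/3) \<le> \<epsilon> * q * L" using L \<epsilon> by (intro mult_left_mono) auto
        then have eq: "\<epsilon> * q \<le> 1/2" using small c by simp
        \<comment> \<open>Since 4/9 \<le> L^2, the constant 16 is at most 36 L^2, and 2 + 36 =
          38.\<close>
        have "2 * (ln M)\<^sup>2 + 16 \<le> 38 * L\<^sup>2" using L \<open>4/9 \<le> L\<^sup>2\<close> by linarith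
        then have "(\<epsilon> * q)\<^sup>2 * (2 * (ln M)\<^sup>2 + 16) \<le> (\<epsilon> * q)\<^sup>2 * (38 * L\<^sup>2)"
          by (intro mult_left_mono) auto
        also have "\<dots> = 38 * (\<epsilon> * q * L)\<^sup>2" by (simp add: power_mult_distrib)
        also have "\<dots> \<le> 38 * c\<^sup>2" using small \<epsilon> L by (intro mult_left_mono power_mono) auto
        finally have "\<kappa> * ((\<epsilon> * q)\<^sup>2 * (2 * (ln M)\<^sup>2 + 16)) \<le> \<kappa> * (38 * c\<^sup>2)"
          using \<kappa> by (intro mult_left_mono) auto
        with \<kappa>c have "\<kappa> * ((\<epsilon> * q)\<^sup>2 * (2 * (ln M)\<^sup>2 + 16)) < \<delta> / 2" by linarith
        then show False using not_small[of \<epsilon>] 3 \<epsilon> eq corr by auto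
      qed
    qed
  qed
qed

end
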